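(* Let $\mathbb{S}^3=\{(x_1,y_1,x_2,y_2)\in\mathbb{R}^4 : x_1^2+y_1^2+x_2^2+y_2^2=1\}$ carry its standard round metric $g$. Let $\varphi=\pi\circ\psi:\mathbb{S}^3\to\mathbb{S}^2(\tfrac12)$, where $$\pi(x_1,y_1,x_2,y_2)=\big(2(x_1x_2+y_1y_2),\ 2(x_1y_2-x_2y_1),\ x_1^2+y_1^2-x_2^2-y_2^2\big)$$ is the Hopf map and $$\psi:\mathbb{S}^3\to\mathbb{S}^3,\qquad \psi(x_1,y_1,x_2,y_2)=(x_1^2-y_1^2-x_2^2-y_2^2,\ 2x_1y_1,\ 2x_1x_2,\ 2x_1y_2).$$ Let $\omega$ be the area 2-form of the round metric on the codomain $\mathbb{S}^2(\tfrac12)$. Then: (i) The vector field $V=(\ast\varphi^*\omega)^\sharp$ is an $\mathbb{S}$-integrable steady Euler field on $\mathbb{S}^3$ with associated Bernoulli function $b=8x_1^2(x_2^2+y_2^2)$ and pressure $p=-8x_1^4$. Its explicit expression with respect to the standard global orthonormal frame $\{\xi,X_1,X_2\}$ on $\mathbb{S}^3$ is $$V=4x_1\,(x_1\,\xi-y_2\,X_1+x_2\,X_2).$$ (ii) The almost submersion $\varphi$ is a smooth critical point, of Hopf invariant $Q(\varphi)=2$, of the quartic Faddeev-Skyrme energy $$E(\varphi)=\frac12\int_{\mathbb{S}^3}\{|\varphi^*\omega|^2+2(1-\varphi_3)\}\,\upsilon_g,$$ with the potential $P(\varphi)=1-\varphi_3$, where $\varphi_3$ is the third component of $\varphi$ seen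 as a map to $\mathbb{R}^3$.
   Context: **Codomain.** $\mathbb{S}^2(\tfrac12)$ denotes the 2-sphere with the round metric of radius $\tfrac12$. Its points are represented by points of the unit sphere in $\mathbb{R}^3$ (so $\pi$ and $\varphi$ are given by unit vectors in $\mathbb{R}^3$, and $\varphi=(\varphi_1,\varphi_2,\varphi_3)$ with $\varphi_1^2+\varphi_2^2+\varphi_3^2=1$), the metric being $\tfrac14$ of the unit round metric. The area form is $\omega=\tfrac14\sin u\,\mathrm{d}u\wedge\mathrm{d}v$ in the chart $(\sin u\,e^{\mathrm{i}v},\cos u)$, with $\mathbb{R}^3=\mathbb{C}\times\mathbb{R}$; its total area is $\pi^2/\pi=\pi$. **Frame and orientation on $\mathbb{S}^3$.** The standard global orthonormal frame is $$\xi=-y_1\partial_{x_1}+x_1\partial_{y_1}-y_2\partial_{x_2}+x_2\partial_{y_2},$$ $$X_1=-x_2\partial_{x_1}+y_2\partial_{y_1}+x_1\partial_{x_2}-y_1\partial_{y_2},$$ $$X_2=-y_2\partial_{x_1}-x_2\partial_{y_1}+y_1\partial_{x_2}+x_1\partial_{y_2}.$$ Let $\eta=\xi^\flat$ be the 1-form dual to $\xi$. The orientation of $\mathbb{S}^3$ is given by the metric volume element $\upsilon_g=\tfrac12\,\eta\wedge\mathrm{d}\eta$ (so that $\ast\mathrm{d}\eta=2\eta$), where $\ast$ is the Hodge star of $g$. The musical isomorphisms $\flat,\sharp$ are with respect to $g$. **Steady Euler fields.** A steady Euler field on a Riemannian 3-manifold $(M,g)$ is a tangent vector field $V$ satisfying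 $\nabla_V V=-\mathrm{grad}\,p$ and $\mathrm{div}\,V=0$ for some function $p$ on $M$ (the pressure). Equivalently, $V\times\mathrm{curl}\,V=\mathrm{grad}\,b$ and $\mathrm{div}\,V=0$, where $b=p+\tfrac12|V|^2$ is the Bernoulli function and $\mathrm{curl}\,V=(\ast\mathrm{d}V^\flat)^\sharp$. (The flow of such a $V$ is called a steady Euler flow.) **$S$-integrability.** A vector field $V$ on a 3-manifold $M$ is $S$-integrable if there is a smooth (at least $C^2$) map $\varphi:M\to N$ to some surface $N$ such that $V_x\in\ker(\mathrm{d}\varphi_x)$ at every regular point $x$ of $\varphi$ and $V$ vanishes on the critical set $C_\varphi=\{x\in M:\mathrm{rank}(\mathrm{d}\varphi_x)<2\}$. It is called $\mathbb{S}$-integrable when $N$ is the round 2-sphere. **Almost submersion.** A map that is a submersion on a dense subset of its domain. **Faddeev-Skyrme energy.** $|\varphi^*\omega|$ is the pointwise norm of the 2-form $\varphi^*\omega$ induced by $g$ (so $|\varphi^*\omega|=|(\ast\varphi^*\omega)^\sharp|$). A critical point of $E$ is a map at which the first variation of $E$ vanishes for all smooth variations through maps $\mathbb{S}^3\to\mathbb{S}^2(\tfrac12)$. **Hopf invariant.** For a smooth map $\varphi:\mathbb{S}^3\to\mathbb{S}^2(\tfrac12)$, $$Q(\varphi)=\frac{1}{\left(\int_{\mathbb{S}^2(1/2)}\omega\right)^2}\int_{\mathbb{S}^3}\alpha\wedge\varphi^*\omega,$$ where $\alpha$ is any 1-form on $\mathbb{S}^3$ with $\mathrm{d}\alpha=\varphi^*\omega$.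 With these conventions $Q(\pi)=1$. *)

theory Defs
  imports "HOL-Analysis.Analysis"
begin

text \<open>
  The sphere \<open>S3\<close> is treated as a submanifold of \<open>real^4\<close>, a point being
  \<open>x = (x1, y1, x2, y2) = (x $ 1, x $ 2, x $ 3, x $ 4)\<close>. Objects on \<open>S3\<close> are total functions
  on \<open>real^4\<close> of which only the values on \<open>S3\<close> (and, for forms, on tangent vectors) matter.
  Derivatives along \<open>S3\<close> are taken through the smooth retraction \<open>sgn\<close>, i.e.
  \<open>x \<mapsto> x / norm x\<close>, of \<open>- {0}\<close> onto \<open>S3\<close>: a map \<open>f\<close> on \<open>S3\<close> is
  of class \<open>C^k\<close> iff its radial extension \<open>f \<circ> sgn\<close> is of class \<open>C^k\<close> on \<open>- {0}\<close>, and
  at points of \<open>S3\<close> the derivative of that extension restricts to the differential of \<open>f\<close>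
  on tangent vectors (and kills the radial direction).
\<close>

section \<open>Differentiability classes\<close>

text \<open>Intended for open \<open>S\<close> in a finite-dimensional space.\<close>

primrec Ck_on :: "nat \<Rightarrow> ('a::real_normed_vector \<Rightarrow> 'b::real_normed_vector) \<Rightarrow> 'a set \<Rightarrow> bool" where
  "Ck_on 0 f S \<longleftrightarrow> continuous_on S f"
| "Ck_on (Suc k) f S \<longleftrightarrow>
     (\<forall>x\<in>S. f differentiable (at x)) \<and>
     (\<forall>v. Ck_on k (\<lambda>x. frechet_derivative f (at x) v) S)"

definition smooth_on :: "('a::real_normed_vector \<Rightarrow> 'b::real_normed_vector) \<Rightarrow> 'a set \<Rightarrow> bool" where
  "smooth_on f S \<longleftrightarrow> (\<forall>k. Ck_on k f S)"


section \<open>Calculus on the 3-sphere\<close>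

definition S3 :: "(real^4) set" where
  "S3 = sphere 0 1"

definition S2 :: "(real^3) set" where
  "S2 = sphere 0 1"

definition tangent :: "real^4 \<Rightarrow> (real^4) set" where
  "tangent x = {v. v \<bullet> x = 0}"

definition Ck_S3 :: "nat \<Rightarrow> (real^4 \<Rightarrow> 'b::real_normed_vector) \<Rightarrow> bool" where
  "Ck_S3 k f \<longleftrightarrow> Ck_on k (\<lambda>y. f (sgn y)) (- {0})"

definition smooth_S3 :: "(real^4 \<Rightarrow> 'b::real_normed_vector) \<Rightarrow> bool" where
  "smooth_S3 f \<longleftrightarrow> (\<forall>k. Ck_S3 k f)"

definition differential :: "(real^4 \<Rightarrow> 'b::real_normed_vector) \<Rightarrow> real^4 \<Rightarrow> real^4 \<Rightarrow> 'b" where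
  "differential f x = frechet_derivative (\<lambda>y. f (sgn y)) (at x)"

definition \<xi> :: "real^4 \<Rightarrow> real^4" where
  "\<xi> x = vector [- x$2, x$1, - x$4, x$3]"

definition X1 :: "real^4 \<Rightarrow> real^4" where
  "X1 x = vector [- x$3, x$4, x$1, - x$2]"

definition X2 :: "real^4 \<Rightarrow> real^4" where
  "X2 x = vector [- x$4, - x$3, x$2, x$1]"


subsection \<open>Differential forms\<close>

type_synonym form1 = "real^4 \<Rightarrow> real^4 \<Rightarrow> real"
type_synonym form2 = "real^4 \<Rightarrow> real^4 \<Rightarrow> real^4 \<Rightarrow> real"
type_synonym form3 = "real^4 \<Rightarrow> real^4 \<Rightarrow> real^4 \<Rightarrow> real^4 \<Rightarrow> real"

text \<open>The pullback of a 1-form on \<open>S3\<close> to \<open>- {0}\<close> along the retraction \<open>sgn\<close>.\<close>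

definition radial_pullback :: "form1 \<Rightarrow> form1" where
  "radial_pullback \<alpha> y v = \<alpha> (sgn y) (frechet_derivative sgn (at y) v)"

definition smooth_form1 :: "form1 \<Rightarrow> bool" where
  "smooth_form1 \<alpha> \<longleftrightarrow>
     (\<forall>x\<in>S3. \<exists>L. linear L \<and> (\<forall>v\<in>tangent x. \<alpha> x v = L v)) \<and>
     (\<forall>v. smooth_on (\<lambda>y. radial_pullback \<alpha> y v) (- {0}))"

text \<open>
  On tangent vectors of \<open>S3\<close> this is the exterior derivative, as it commutes with
  pullbacks and \<open>sgn\<close> restricts to the identity on \<open>S3\<close>; the formula is that of the exterior
  derivative on \<open>real^4\<close>, with \<open>v\<close> and \<open>w\<close> as constant vector fields.
\<close>

definition ext_deriv :: "form1 \<Rightarrow> form2" where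
  "ext_deriv \<alpha> x v w =
     frechet_derivative (\<lambda>y. radial_pullback \<alpha> y w) (at x) v -
     frechet_derivative (\<lambda>y. radial_pullback \<alpha> y v) (at x) w"

definition wedge12 :: "form1 \<Rightarrow> form2 \<Rightarrow> form3" where
  "wedge12 \<alpha> \<beta> x u v w = \<alpha> x u * \<beta> x v w + \<alpha> x v * \<beta> x w u + \<alpha> x w * \<beta> x u v"

definition \<eta> :: form1 where
  "\<eta> x v = \<xi> x \<bullet> v"

definition vol_form :: form3 where
  "vol_form x u v w = 1/2 * wedge12 \<eta> (ext_deriv \<eta>) x u v w"

text \<open>
  The Hodge star and the norm of a 2-form, expressed in the frame \<open>\<xi>, X1, X2\<close>, which is
  orthonormal and positively oriented (\<open>frame_tangent\<close>, \<open>frame_orthonormal\<close> and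
  \<open>vol_form_frame\<close> below).
\<close>

definition hodge_star :: "form2 \<Rightarrow> form1" where
  "hodge_star \<beta> x v =
     \<beta> x (X1 x) (X2 x) * (\<xi> x \<bullet> v) +
     \<beta> x (X2 x) (\<xi> x) * (X1 x \<bullet> v) +
     \<beta> x (\<xi> x) (X1 x) * (X2 x \<bullet> v)"

definition form2_norm :: "form2 \<Rightarrow> real^4 \<Rightarrow> real" where
  "form2_norm \<beta> x =
     sqrt ((\<beta> x (X1 x) (X2 x))\<^sup>2 + (\<beta> x (X2 x) (\<xi> x))\<^sup>2 + (\<beta> x (\<xi> x) (X1 x))\<^sup>2)"

definition sharp :: "form1 \<Rightarrow> real^4 \<Rightarrow> real^4" where
  "sharp \<alpha> x = \<alpha> x (\<xi> x) *\<^sub>R \<xi> x + \<alpha> x (X1 x) *\<^sub>R X1 x + \<alpha> x (X2 x) *\<^sub>R X2 x"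


subsection \<open>Integration of 3-forms\<close>

text \<open>
  Coordinates \<open>(s, a, b)\<close> with \<open>x1 + i y1 = sin s exp (i a)\<close> and
  \<open>x2 + i y2 = cos s exp (i b)\<close>. On the interior of the box below they parametrize \<open>S3\<close>
  diffeomorphically up to a null set, and in this order they are positively oriented:
  the volume form pulls back to \<open>sin s cos s ds da db\<close>.
\<close>

definition S3_coords :: "real \<times> real \<times> real \<Rightarrow> real^4" where
  "S3_coords = (\<lambda>(s, a, b). vector [sin s * cos a, sin s * sin a, cos s * cos b, cos s * sin b])"

definition S3_integral :: "form3 \<Rightarrow> real" where
  "S3_integral \<Theta> =
     integral (cbox (0, 0, 0) (pi/2, 2*pi, 2*pi))
       (\<lambda>q. \<Theta> (S3_coords q)
              (frechet_derivative S3_coords (at q) (1, 0, 0))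
              (frechet_derivative S3_coords (at q) (0, 1, 0))
              (frechet_derivative S3_coords (at q) (0, 0, 1)))"


section \<open>The codomain and its area form\<close>

text \<open>
  The area form of the sphere of radius 1/2, carried over to the unit sphere: \<open>1/4\<close> of the
  unit round area form for the outward normal, so that it is \<open>1/4 sin u du dv\<close> in the
  chart \<open>S2_coords\<close> (\<open>area_form_chart\<close> below).
\<close>

definition area_form :: "real^3 \<Rightarrow> real^3 \<Rightarrow> real^3 \<Rightarrow> real" where
  "area_form n a b = 1/4 * (n \<bullet> cross3 a b)"

definition S2_coords :: "real \<times> real \<Rightarrow> real^3" where
  "S2_coords = (\<lambda>(u, v). vector [sin u * cos v, sin u * sin v, cos u])"

definition S2_total_area :: real where
  "S2_total_area =
     integral (cbox (0, 0) (pi, 2*pi))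
       (\<lambda>q. area_form (S2_coords q)
              (frechet_derivative S2_coords (at q) (1, 0))
              (frechet_derivative S2_coords (at q) (0, 1)))"

definition smooth_map_S3_S2 :: "(real^4 \<Rightarrow> real^3) \<Rightarrow> bool" where
  "smooth_map_S3_S2 \<phi> \<longleftrightarrow> smooth_S3 \<phi> \<and> \<phi> ` S3 \<subseteq> S2"

definition pullback_area :: "(real^4 \<Rightarrow> real^3) \<Rightarrow> form2" where
  "pullback_area \<phi> x v w = area_form (\<phi> x) (differential \<phi> x v) (differential \<phi> x w)"

definition rank_at :: "(real^4 \<Rightarrow> real^3) \<Rightarrow> real^4 \<Rightarrow> nat" where
  "rank_at \<phi> x = dim (differential \<phi> x ` tangent x)"

definition almost_submersion :: "(real^4 \<Rightarrow> real^3) \<Rightarrow> bool" where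
  "almost_submersion \<phi> \<longleftrightarrow> S3 \<subseteq> closure {x\<in>S3. rank_at \<phi> x = 2}"


section \<open>Steady Euler fields and integrability\<close>

definition smooth_vector_field :: "(real^4 \<Rightarrow> real^4) \<Rightarrow> bool" where
  "smooth_vector_field V \<longleftrightarrow> smooth_S3 V \<and> (\<forall>x\<in>S3. V x \<in> tangent x)"

text \<open>
  The Levi-Civita connection of the round metric: the tangential part of the derivative
  in \<open>real^4\<close>.
\<close>

definition cov_deriv :: "(real^4 \<Rightarrow> real^4) \<Rightarrow> real^4 \<Rightarrow> real^4 \<Rightarrow> real^4" where
  "cov_deriv V x v = differential V x v - (differential V x v \<bullet> x) *\<^sub>R x"

definition grad :: "(real^4 \<Rightarrow> real) \<Rightarrow> real^4 \<Rightarrow> real^4" where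
  "grad p = sharp (differential p)"

definition divergence :: "(real^4 \<Rightarrow> real^4) \<Rightarrow> real^4 \<Rightarrow> real" where
  "divergence V x =
     cov_deriv V x (\<xi> x) \<bullet> \<xi> x + cov_deriv V x (X1 x) \<bullet> X1 x + cov_deriv V x (X2 x) \<bullet> X2 x"

definition steady_euler_with_pressure :: "(real^4 \<Rightarrow> real^4) \<Rightarrow> (real^4 \<Rightarrow> real) \<Rightarrow> bool" where
  "steady_euler_with_pressure V p \<longleftrightarrow>
     smooth_vector_field V \<and> smooth_S3 p \<and>
     (\<forall>x\<in>S3. cov_deriv V x (V x) = - grad p x) \<and>
     (\<forall>x\<in>S3. divergence V x = 0)"

definition steady_euler_field :: "(real^4 \<Rightarrow> real^4) \<Rightarrow> bool" where
  "steady_euler_field V \<longleftrightarrow> (\<exists>p. steady_euler_with_pressure V p)"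

definition bernoulli :: "(real^4 \<Rightarrow> real^4) \<Rightarrow> (real^4 \<Rightarrow> real) \<Rightarrow> real^4 \<Rightarrow> real" where
  "bernoulli V p x = p x + 1/2 * (norm (V x))\<^sup>2"

definition S2_integrable :: "(real^4 \<Rightarrow> real^4) \<Rightarrow> bool" where
  "S2_integrable V \<longleftrightarrow>
     smooth_vector_field V \<and>
     (\<exists>\<phi> :: real^4 \<Rightarrow> real^3. Ck_S3 2 \<phi> \<and> \<phi> ` S3 \<subseteq> S2 \<and>
        (\<forall>x\<in>S3. rank_at \<phi> x = 2 \<longrightarrow> differential \<phi> x (V x) = 0) \<and>
        (\<forall>x\<in>S3. rank_at \<phi> x < 2 \<longrightarrow> V x = 0))"


section \<open>Hopf invariant and Faddeev-Skyrme energy\<close>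

definition area_primitive :: "(real^4 \<Rightarrow> real^3) \<Rightarrow> form1 \<Rightarrow> bool" where
  "area_primitive \<phi> \<alpha> \<longleftrightarrow>
     smooth_form1 \<alpha> \<and>
     (\<forall>x\<in>S3. \<forall>v\<in>tangent x. \<forall>w\<in>tangent x. ext_deriv \<alpha> x v w = pullback_area \<phi> x v w)"

text \<open>
  A relation rather than a function, so that the existence of a primitive and the independence
  of its choice are part of what it asserts.
\<close>

definition has_hopf_invariant :: "(real^4 \<Rightarrow> real^3) \<Rightarrow> real \<Rightarrow> bool" where
  "has_hopf_invariant \<phi> Q \<longleftrightarrow>
     (\<exists>\<alpha>. area_primitive \<phi> \<alpha>) \<and>
     (\<forall>\<alpha>. area_primitive \<phi> \<alpha> \<longrightarrow>
        Q = 1 / S2_total_area\<^sup>2 * S3_integral (wedge12 \<alpha> (pullback_area \<phi>)))"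

definition FS_energy :: "(real^4 \<Rightarrow> real^3) \<Rightarrow> real" where
  "FS_energy \<phi> =
     1/2 * S3_integral (\<lambda>x u v w.
       ((form2_norm (pullback_area \<phi>) x)\<^sup>2 + 2 * (1 - \<phi> x $ 3)) * vol_form x u v w)"

definition smooth_variation ::
  "(real^4 \<Rightarrow> real^3) \<Rightarrow> real \<Rightarrow> (real \<Rightarrow> real^4 \<Rightarrow> real^3) \<Rightarrow> bool" where
  "smooth_variation \<phi> \<epsilon> \<Phi> \<longleftrightarrow>
     0 < \<epsilon> \<and>
     smooth_on (\<lambda>(t, y). \<Phi> t (sgn y)) ({-\<epsilon><..<\<epsilon>} \<times> (- {0})) \<and>
     (\<forall>t\<in>{-\<epsilon><..<\<epsilon>}. \<Phi> t ` S3 \<subseteq> S2) \<and>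
     (\<forall>x\<in>S3. \<Phi> 0 x = \<phi> x)"

definition FS_critical :: "(real^4 \<Rightarrow> real^3) \<Rightarrow> bool" where
  "FS_critical \<phi> \<longleftrightarrow>
     smooth_map_S3_S2 \<phi> \<and>
     (\<forall>\<epsilon> \<Phi>. smooth_variation \<phi> \<epsilon> \<Phi> \<longrightarrow>
        ((\<lambda>t. FS_energy (\<Phi> t)) has_real_derivative 0) (at 0))"


section \<open>The maps\<close>

definition hopf_map :: "real^4 \<Rightarrow> real^3" where
  "hopf_map x = vector
     [2 * (x$1 * x$3 + x$2 * x$4),
      2 * (x$1 * x$4 - x$3 * x$2),
      (x$1)\<^sup>2 + (x$2)\<^sup>2 - (x$3)\<^sup>2 - (x$4)\<^sup>2]"

definition \<psi> :: "real^4 \<Rightarrow> real^4" where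
  "\<psi> x = vector
     [(x$1)\<^sup>2 - (x$2)\<^sup>2 - (x$3)\<^sup>2 - (x$4)\<^sup>2,
      2 * x$1 * x$2,
      2 * x$1 * x$3,
      2 * x$1 * x$4]"


section \<open>Consistency of the conventions\<close>

lemma vector_4 [simp]:
  "(vector [a, b, c, d] :: real^4) $ 1 = a"
  "(vector [a, b, c, d] :: real^4) $ 2 = b"
  "(vector [a, b, c, d] :: real^4) $ 3 = c"
  "(vector [a, b, c, d] :: real^4) $ 4 = d"
  unfolding vector_def by simp_all

lemma frame_tangent: "\<xi> x \<in> tangent x" "X1 x \<in> tangent x" "X2 x \<in> tangent x"
  by (simp_all add: tangent_def \<xi>_def X1_def X2_def inner_vec_def sum_4)

lemma frame_orthonormal:
  assumes "x \<in> S3"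
  shows "\<xi> x \<bullet> \<xi> x = 1" "X1 x \<bullet> X1 x = 1" "X2 x \<bullet> X2 x = 1"
    and "\<xi> x \<bullet> X1 x = 0" "X1 x \<bullet> X2 x = 0" "X2 x \<bullet> \<xi> x = 0"
proof -
  have "x \<bullet> x = 1"
    using assms by (simp add: S3_def dot_square_norm)
  then have "x$1 * x$1 + x$2 * x$2 + x$3 * x$3 + x$4 * x$4 = 1"
    by (simp add: inner_vec_def sum_4)
  then show "\<xi> x \<bullet> \<xi> x = 1" "X1 x \<bullet> X1 x = 1" "X2 x \<bullet> X2 x = 1"
    and "\<xi> x \<bullet> X1 x = 0" "X1 x \<bullet> X2 x = 0" "X2 x \<bullet> \<xi> x = 0"
    by (simp_all add: \<xi>_def X1_def X2_def inner_vec_def sum_4)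
qed

lemma sgn_has_derivative:
  fixes x :: "real^4"
  assumes "x \<noteq> 0"
  shows "(sgn has_derivative (\<lambda>v. (1 / norm x) *\<^sub>R (v - (sgn x \<bullet> v) *\<^sub>R sgn x))) (at x)"
proof -
  have "((\<lambda>y. inverse (norm y) *\<^sub>R y) has_derivative
          (\<lambda>v. inverse (norm x) *\<^sub>R v + (- (inverse (norm x) * (v \<bullet> sgn x) * inverse (norm x))) *\<^sub>R x)) (at x)"
    by (rule derivative_eq_intros has_derivative_norm assms refl | simp add: assms)+
  moreover have "sgn = (\<lambda>y::real^4. inverse (norm y) *\<^sub>R y)"
    by (simp add: fun_eq_iff sgn_div_norm)
  moreover have "(\<lambda>v. inverse (norm x) *\<^sub>R v + (- (inverse (norm x) * (v \<bullet> sgn x) * inverse (norm x))) *\<^sub>R x) =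
      (\<lambda>v. (1 / norm x) *\<^sub>R (v - (sgn x \<bullet> v) *\<^sub>R sgn x))"
    by (simp add: fun_eq_iff sgn_div_norm divide_inverse algebra_simps inner_commute)
  ultimately show ?thesis
    by metis
qed

lemma \<xi>_scaleR: "\<xi> (c *\<^sub>R x) = c *\<^sub>R \<xi> x"
  by (simp add: \<xi>_def vec_eq_iff forall_4)

lemma ext_deriv_\<eta>:
  assumes "x \<in> S3" "v \<in> tangent x" "w \<in> tangent x"
  shows "ext_deriv \<eta> x v w = 2 * (\<xi> v \<bullet> w)"
proof -
  have lin: "bounded_linear \<xi>"
    by (intro linear_conv_bounded_linear[THEN iffD1] linearI)
       (simp_all add: \<xi>_def vec_eq_iff forall_4)
  have x: "norm x = 1" "x \<noteq> 0"
    using assms(1) by (auto simp: S3_def)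
  have eq: "radial_pullback \<eta> y u = inverse ((norm y)\<^sup>2) * (\<xi> y \<bullet> u)" if "y \<noteq> 0" for y u
  proof -
    have "\<xi> y \<bullet> y = 0"
      using frame_tangent(1)[of y] by (simp add: tangent_def)
    moreover have "frechet_derivative sgn (at y) u
        = (1 / norm y) *\<^sub>R (u - (sgn y \<bullet> u) *\<^sub>R sgn y)"
      by (rule fun_cong[OF frechet_derivative_at[OF sgn_has_derivative[OF that], symmetric]])
    ultimately show ?thesis
      by (simp add: radial_pullback_def \<eta>_def sgn_div_norm \<xi>_scaleR inner_diff_right
          power2_eq_square divide_inverse)
  qed
  have D: "frechet_derivative (\<lambda>y. radial_pullback \<eta> y u) (at x) z = \<xi> z \<bullet> u"
    if "z \<in> tangent x" for u z
  proof -
    have zx: "z \<bullet> x = 0" using that by (simp add: tangent_def)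
    have "((\<lambda>y. inverse (y \<bullet> y) * (\<xi> y \<bullet> u)) has_derivative
            (\<lambda>z. inverse (x \<bullet> x) * (\<xi> z \<bullet> u) +
                 - (inverse (x \<bullet> x) * (x \<bullet> z + z \<bullet> x) * inverse (x \<bullet> x)) * (\<xi> x \<bullet> u))) (at x)"
    proof -
      have "x \<bullet> x \<noteq> 0"
        using x by simp
      moreover have "((\<lambda>y. y \<bullet> y) has_derivative (\<lambda>z. x \<bullet> z + z \<bullet> x)) (at x)"
        by (rule has_derivative_inner[OF has_derivative_ident has_derivative_ident])
      moreover have "((\<lambda>y. \<xi> y \<bullet> u) has_derivative (\<lambda>z. \<xi> z \<bullet> u)) (at x)"
        by (rule bounded_linear_imp_has_derivative[OF
              bounded_linear_compose[OF bounded_linear_inner_left lin]])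
      ultimately show ?thesis
        by (intro has_derivative_mult[OF Deriv.has_derivative_inverse, THEN has_derivative_eq_rhs]) auto
    qed
    then have "((\<lambda>y. radial_pullback \<eta> y u) has_derivative
            (\<lambda>z. inverse (x \<bullet> x) * (\<xi> z \<bullet> u) +
                 - (inverse (x \<bullet> x) * (x \<bullet> z + z \<bullet> x) * inverse (x \<bullet> x)) * (\<xi> x \<bullet> u))) (at x)"
      by (rule has_derivative_transform_within_open[where s="- {0}"])
         (use x in \<open>auto simp: eq dot_square_norm\<close>)
    then have "frechet_derivative (\<lambda>y. radial_pullback \<eta> y u) (at x) z =
        inverse (x \<bullet> x) * (\<xi> z \<bullet> u) +
        - (inverse (x \<bullet> x) * (x \<bullet> z + z \<bullet> x) * inverse (x \<bullet> x)) * (\<xi> x \<bullet> u)"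
      by (rule fun_cong[OF frechet_derivative_at[symmetric]])
    then show ?thesis
      by (simp add: zx inner_commute[of x z] dot_square_norm x)
  qed
  have "\<xi> w \<bullet> v = - (\<xi> v \<bullet> w)"
    by (simp add: \<xi>_def inner_vec_def sum_4 algebra_simps)
  then show ?thesis
    by (simp add: ext_deriv_def D assms)
qed

lemma vol_form_frame:
  assumes "x \<in> S3"
  shows "vol_form x (\<xi> x) (X1 x) (X2 x) = 1"
proof -
  have "x \<bullet> x = 1"
    using assms by (simp add: S3_def dot_square_norm)
  then have "\<xi> (X1 x) \<bullet> X2 x = 1"
    by (simp add: \<xi>_def X1_def X2_def inner_vec_def sum_4)
  then show ?thesis
    using frame_orthonormal[OF assms]
    by (simp add: vol_form_def wedge12_def \<eta>_def ext_deriv_\<eta> frame_tangent assms inner_commute)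
qed

lemma area_form_chart:
  "area_form (S2_coords (u, v))
     (frechet_derivative S2_coords (at (u, v)) (1, 0))
     (frechet_derivative S2_coords (at (u, v)) (0, 1)) = 1/4 * sin u"
proof -
  let ?D = "\<lambda>h::real \<times> real.
     (cos u * fst h * cos v - sin u * (sin v * snd h)) *\<^sub>R (axis 1 1 :: real^3) +
     (cos u * fst h * sin v + sin u * (cos v * snd h)) *\<^sub>R axis 2 1 +
     (- sin u * fst h) *\<^sub>R axis 3 1"
  have eq: "S2_coords = (\<lambda>q. (sin (fst q) * cos (snd q)) *\<^sub>R axis 1 1 +
      (sin (fst q) * sin (snd q)) *\<^sub>R axis 2 1 + cos (fst q) *\<^sub>R axis 3 1)"
    by (auto simp: fun_eq_iff S2_coords_def vec_eq_iff forall_3 axis_def)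
  have "(S2_coords has_derivative ?D) (at (u, v))"
    unfolding eq by (auto intro!: derivative_eq_intros simp: fun_eq_iff algebra_simps)
  then have D: "frechet_derivative S2_coords (at (u, v)) = ?D"
    by (rule frechet_derivative_at[symmetric])
  have "area_form (S2_coords (u, v)) (?D (1, 0)) (?D (0, 1)) =
      1/4 * (sin u * ((sin u)\<^sup>2 + (cos u)\<^sup>2) * ((sin v)\<^sup>2 + (cos v)\<^sup>2))"
    by (simp add: area_form_def S2_coords_def cross3_def inner_vec_def sum_3 axis_def
        power2_eq_square) algebra
  then show ?thesis
    by (simp add: D)
qed

end

theory Submission
  imports Defs
begin

text \<open>
  Identify \<open>S3\<close> with the unit quaternions. Then \<open>\<psi>\<close> is quaternionic squaring, and the Hopf map pulls the
  area form back to \<open>1/2 d\<eta>\<close>. So the pullback of the area form along \<open>\<phi> = hopf_map \<circ> \<psi>\<close> is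
  \<open>\<Omega>(v, w) = \<xi> (d\<psi> v) \<bullet> d\<psi> w\<close> (\<open>pullback_area_phi\<close>), an expression of low degree from which the coefficients of
  the field \<open>V\<close> in the frame are read off. After that, everything that is asserted about \<open>V\<close> pointwise is an
  identity between polynomials in the coordinates, modulo \<open>x \<bullet> x = 1\<close>: most of the identities become exact
  when the side of lower degree is multiplied by a power of \<open>x \<bullet> x\<close>, and they are proved in that form. The
  field is tangent to the fibres of \<open>\<phi>\<close> because \<open>d\<psi> V = 8 x1\<^sup>2 \<xi>(\<psi>)\<close> (\<open>psi_deriv_euler\<close>) is vertical for the
  Hopf map; and \<open>V\<close> vanishes exactly where \<open>\<Omega>\<close> does, which on \<open>S3\<close> is the set \<open>x1 = 0\<close>, with dense complement.

  Criticality and the Hopf invariant both rest on one case of Stokes' theorem (\<open>stokes_S3\<close>): the integrals of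
  \<open>\<alpha> \<and> d\<beta>\<close> and of \<open>\<beta> \<and> d\<alpha>\<close> over \<open>S3\<close> agree, since the two 3-forms differ by \<open>d(\<alpha> \<and> \<beta>)\<close>. For the Hopf
  invariant, it shows that all primitives of \<open>\<Omega>\<close> give the same integral. The primitive
  \<open>\<alpha>0 = 1/2 \<psi>\<^sup>*\<eta>\<close> satisfies \<open>\<alpha>0 \<and> \<Omega> = 4 x1\<^sup>2 vol\<close>, with integral \<open>2 \<pi>\<^sup>2\<close>, while the target has area \<open>\<pi>\<close>.

  For criticality let \<open>W\<close> be the variation field, and let \<open>\<beta>\<close> be the 1-form
  \<open>v \<mapsto> \<omega>(W, d\<phi> v)\<close>. Second derivatives commute and three tangent vectors of a surface are linearly dependent;
  therefore the derivative of \<open>\<Omega>\<close> along the variation is \<open>d\<beta>\<close> (\<open>N'_0\<close>). The first variation of the energy is then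
  the integral of \<open>V\<^sup>\<flat> \<and> d\<beta> - W\<^sub>3 vol\<close>, which by Stokes' theorem is that of \<open>\<beta> \<and> dV\<^sup>\<flat> - W\<^sub>3 vol\<close>.
  The last integrand vanishes identically: \<open>\<beta> \<and> dV\<^sup>\<flat> = \<omega>(W, d\<phi> (curl V)) vol\<close>, and
  \<open>d\<phi> (curl V) = 4 \<phi> \<times> e\<^sub>3\<close> is a multiple of the field of rotations of the target about the axis of the potential
  (\<open>phi_deriv_curl\<close>).
\<close>

section \<open>Functions of class \<open>C^k\<close>\<close>

lemma Ck_on_cong:
  assumes "Ck_on k f S" "open S" "\<And>x. x \<in> S \<Longrightarrow> f x = g x"
  shows "Ck_on k g S"
  using assms
proof (induction k arbitrary: f g)
  case 0
  then show ?case by (simp cong: continuous_on_cong)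
next
  case (Suc k)
  have "g differentiable at x" and "frechet_derivative g (at x) = frechet_derivative f (at x)"
    if "x \<in> S" for x
  proof -
    have "f differentiable at x" using Suc.prems that by simp
    then have "(f has_derivative frechet_derivative f (at x)) (at x)"
      by (simp add: frechet_derivative_works)
    then have D: "(g has_derivative frechet_derivative f (at x)) (at x)"
      by (rule has_derivative_transform_within_open[OF _ \<open>open S\<close> that]) (simp add: Suc.prems)
    then show "g differentiable at x" by (rule differentiableI)
    show "frechet_derivative g (at x) = frechet_derivative f (at x)"
      by (rule frechet_derivative_at[OF D, symmetric])
  qed
  then show ?case
    using Suc.prems Suc.IH[of "\<lambda>x. frechet_derivative f (at x) v" "\<lambda>x. frechet_derivative g (at x) v" for v]
    by simp
qed

text \<open>
  Membership in \<open>C^(k+1)\<close> from an explicit formula for the derivative: \<open>frechet_derivative\<close> is a choice operator,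
  but on the open set \<open>S\<close> it has to agree with any derivative that is exhibited.
\<close>

lemma Ck_on_SucI:
  assumes "open S" "\<And>x. x \<in> S \<Longrightarrow> (f has_derivative f' x) (at x)"
    and "\<And>v. Ck_on k (\<lambda>x. f' x v) S"
  shows "Ck_on (Suc k) f S"
proof -
  have "Ck_on k (\<lambda>x. frechet_derivative f (at x) v) S" for v
    by (rule Ck_on_cong[OF assms(3) assms(1)])
       (simp add: frechet_derivative_at[OF assms(2), symmetric])
  then show ?thesis using assms(2) by (auto intro: differentiableI)
qed

lemma Ck_on_Suc_has_derivative:
  assumes "Ck_on (Suc k) f S" "x \<in> S"
  shows "(f has_derivative frechet_derivative f (at x)) (at x)"
  using assms by (simp add: frechet_derivative_works)

lemma Ck_on_Suc_deriv: "Ck_on (Suc k) f S \<Longrightarrow> Ck_on k (\<lambda>x. frechet_derivative f (at x) v) S"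
  by simp

lemma Ck_on_SucD: "Ck_on (Suc k) f S \<Longrightarrow> Ck_on k f S"
proof (induction k arbitrary: f)
  case 0
  then show ?case
    by (auto intro!: continuous_at_imp_continuous_on differentiable_imp_continuous_within)
next
  case (Suc k)
  have "Ck_on k (\<lambda>x. frechet_derivative f (at x) v) S" for v
    by (rule Suc.IH) (use Suc.prems in simp)
  then show ?case using Suc.prems by simp
qed

lemma Ck_on_mono:
  assumes "Ck_on m f S" "k \<le> m"
  shows "Ck_on k f S"
  using assms(2,1) by (induction rule: dec_induct) (blast dest: Ck_on_SucD)+

lemma Ck_on_imp_continuous_on: "Ck_on k f S \<Longrightarrow> continuous_on S f"
  using Ck_on_mono[of k f S 0] by simp

lemma Ck_on_const: "open S \<Longrightarrow> Ck_on k (\<lambda>x. c) S"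
  by (induction k arbitrary: c) auto

lemma Ck_on_bounded_linear:
  assumes "bounded_linear L" "open S"
  shows "Ck_on k L S"
proof (cases k)
  case 0
  then show ?thesis using assms by (simp add: linear_continuous_on)
next
  case (Suc j)
  show ?thesis unfolding Suc
    by (rule Ck_on_SucI[OF assms(2), where f'="\<lambda>_. L"])
       (simp_all add: assms bounded_linear_imp_has_derivative Ck_on_const)
qed

lemma Ck_on_add:
  assumes "Ck_on k f S" "Ck_on k g S" "open S"
  shows "Ck_on k (\<lambda>x. f x + g x) S"
  using assms
proof (induction k arbitrary: f g)
  case 0
  then show ?case by (simp add: continuous_on_add)
next
  case (Suc k)
  show ?case
    by (rule Ck_on_SucI[OF \<open>open S\<close> has_derivative_add])
       (assumption | rule Ck_on_Suc_has_derivative Suc.IH Ck_on_Suc_deriv Suc.prems)+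
qed

lemma Ck_on_bilinear:
  assumes "bounded_bilinear B" "Ck_on k f S" "Ck_on k g S" "open S"
  shows "Ck_on k (\<lambda>x. B (f x) (g x)) S"
  using assms(2-)
proof (induction k arbitrary: f g)
  case 0
  then show ?case using bounded_bilinear.continuous_on[OF assms(1)] by simp
next
  case (Suc k)
  have fg: "Ck_on k f S" "Ck_on k g S"
    by (rule Suc.prems(1,2)[THEN Ck_on_SucD])+
  show ?case
    by (rule Ck_on_SucI[OF \<open>open S\<close> bounded_bilinear.FDERIV[OF assms(1)]])
       (assumption | rule Ck_on_Suc_has_derivative Ck_on_add Suc.IH fg Ck_on_Suc_deriv Suc.prems)+
qed

lemma Ck_on_linear_compose:
  assumes "bounded_linear L" "Ck_on k f S" "open S"
  shows "Ck_on k (\<lambda>x. L (f x)) S"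
  using assms(2-)
proof (induction k arbitrary: f)
  case 0
  then show ?case using bounded_linear.continuous_on[OF assms(1)] by simp
next
  case (Suc k)
  show ?case
    by (rule Ck_on_SucI[OF \<open>open S\<close> bounded_linear.has_derivative[OF assms(1)]])
       (use Suc in \<open>auto intro: Ck_on_Suc_has_derivative\<close>)
qed

lemma Ck_on_affine_compose:
  assumes "Ck_on k f S" "open T" "bounded_linear L" "\<And>x. x \<in> T \<Longrightarrow> c + L x \<in> S"
  shows "Ck_on k (\<lambda>x. f (c + L x)) T"
  using assms(1)
proof (induction k arbitrary: f)
  case 0
  then show ?case
    using assms by (auto intro!: continuous_on_compose2[of S f] continuous_intros
        bounded_linear.continuous_on[OF assms(3)])
next
  case (Suc k)
  show ?case
  proof (rule Ck_on_SucI[OF \<open>open T\<close>, where f'="\<lambda>x v. frechet_derivative f (at (c + L x)) (L v)"])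
    show "((\<lambda>x. f (c + L x)) has_derivative (\<lambda>v. frechet_derivative f (at (c + L x)) (L v))) (at x)"
      if "x \<in> T" for x
    proof (rule has_derivative_compose[of "\<lambda>x. c + L x" L])
      show "((\<lambda>x. c + L x) has_derivative L) (at x)"
        using has_derivative_add[OF has_derivative_const bounded_linear_imp_has_derivative[OF assms(3)]]
        by simp
      show "(f has_derivative frechet_derivative f (at (c + L x))) (at (c + L x))"
        by (rule Ck_on_Suc_has_derivative[OF Suc.prems assms(4)[OF that]])
    qed
    show "Ck_on k (\<lambda>x. frechet_derivative f (at (c + L x)) (L v)) T" for v
      by (rule Suc.IH) (use Suc.prems in simp)
  qed
qed

lemmas Ck_on_mult = Ck_on_bilinear[OF bounded_bilinear_mult]
lemmas Ck_on_scaleR = Ck_on_bilinear[OF bounded_bilinear_scaleR]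
lemmas Ck_on_inner = Ck_on_bilinear[OF bounded_bilinear_inner]
lemmas Ck_on_vec_nth = Ck_on_linear_compose[OF bounded_linear_vec_nth]

lemma Ck_on_minus: "Ck_on k f S \<Longrightarrow> open S \<Longrightarrow> Ck_on k (\<lambda>x. - f x) S"
  by (rule Ck_on_linear_compose[OF bounded_linear_minus[OF bounded_linear_ident]])

lemma Ck_on_diff:
  "Ck_on k f S \<Longrightarrow> Ck_on k g S \<Longrightarrow> open S \<Longrightarrow> Ck_on k (\<lambda>x. f x - g x) S"
  using Ck_on_add[of k f S "\<lambda>x. - g x"] Ck_on_minus[of k g S] by simp

lemma Ck_on_power:
  fixes f :: "'a::real_normed_vector \<Rightarrow> real"
  shows "Ck_on k f S \<Longrightarrow> open S \<Longrightarrow> Ck_on k (\<lambda>x. f x ^ n) S"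
  by (induction n) (auto intro: Ck_on_const Ck_on_mult)

text \<open>
  The only smooth building block on the punctured space that is not polynomial. Its derivative is a polynomial in
  itself and linear forms, so the induction on \<open>k\<close> closes.
\<close>

lemma Ck_on_inverse_norm: "Ck_on k (\<lambda>y::'a::euclidean_space. inverse (norm y)) (- {0})"
proof (induction k)
  case 0
  show ?case by (auto intro!: continuous_intros)
next
  case (Suc k)
  note o = open_Compl[OF closed_singleton[of "0::'a"]]
  show ?case
  proof (rule Ck_on_SucI[OF o, where f'="\<lambda>y v. - (inverse (norm y) ^ 3) * (y \<bullet> v)"])
    fix y :: 'a assume "y \<in> - {0}"
    then have y: "y \<noteq> 0" by simp
    show "((\<lambda>y. inverse (norm y)) has_derivative (\<lambda>v. - (inverse (norm y) ^ 3) * (y \<bullet> v))) (at y)"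
      by (rule has_derivative_eq_rhs, rule Deriv.has_derivative_inverse[OF _ has_derivative_norm[OF y]])
         (use y in \<open>auto simp: fun_eq_iff sgn_div_norm power3_eq_cube divide_inverse inner_commute\<close>)
  next
    show "Ck_on k (\<lambda>y. - (inverse (norm y) ^ 3) * (y \<bullet> v)) (- {0})" for v :: 'a
      by (intro Ck_on_mult Ck_on_minus Ck_on_power Suc.IH o
          Ck_on_bounded_linear bounded_linear_inner_left)
  qed
qed

lemma open_punctured: "open (- {0::'a::euclidean_space})"
  by auto

lemma Ck_on_sgn: "Ck_on k (sgn :: 'a::euclidean_space \<Rightarrow> 'a) (- {0})"
proof -
  have "Ck_on k (\<lambda>y::'a. inverse (norm y) *\<^sub>R y) (- {0})"
    by (intro Ck_on_scaleR Ck_on_inverse_norm open_punctured Ck_on_bounded_linear bounded_linear_ident)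
  then show ?thesis by (simp add: sgn_div_norm[abs_def])
qed

lemma Ck_on_vec4:
  fixes f1 f2 f3 f4 :: "'a::real_normed_vector \<Rightarrow> real"
  assumes "Ck_on k f1 S" "Ck_on k f2 S" "Ck_on k f3 S" "Ck_on k f4 S" "open S"
  shows "Ck_on k (\<lambda>x. vector [f1 x, f2 x, f3 x, f4 x] :: real^4) S"
proof -
  have "(\<lambda>x. vector [f1 x, f2 x, f3 x, f4 x] :: real^4) =
    (\<lambda>x. f1 x *\<^sub>R axis 1 1 + f2 x *\<^sub>R axis 2 1 + f3 x *\<^sub>R axis 3 1 + f4 x *\<^sub>R axis 4 1)"
    by (simp add: fun_eq_iff vec_eq_iff forall_4 axis_def)
  then show ?thesis by (auto intro!: Ck_on_add Ck_on_scaleR Ck_on_const assms)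
qed

lemma Ck_on_vec3:
  fixes f1 f2 f3 :: "'a::real_normed_vector \<Rightarrow> real"
  assumes "Ck_on k f1 S" "Ck_on k f2 S" "Ck_on k f3 S" "open S"
  shows "Ck_on k (\<lambda>x. vector [f1 x, f2 x, f3 x] :: real^3) S"
proof -
  have "(\<lambda>x. vector [f1 x, f2 x, f3 x] :: real^3) =
    (\<lambda>x. f1 x *\<^sub>R axis 1 1 + f2 x *\<^sub>R axis 2 1 + f3 x *\<^sub>R axis 3 1)"
    by (simp add: fun_eq_iff vec_eq_iff forall_3 axis_def)
  then show ?thesis by (auto intro!: Ck_on_add Ck_on_scaleR Ck_on_const assms)
qed

lemmas Ck_on_intros = Ck_on_const Ck_on_add Ck_on_diff Ck_on_minus Ck_on_mult Ck_on_power
  Ck_on_inner Ck_on_vec3 Ck_on_vec4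

section \<open>First and second derivatives in varying directions\<close>

text \<open>
  The classes \<open>Ck_on\<close> control derivatives in one fixed direction at a time. The following expansions over a basis
  give joint continuity in point and direction, which is needed because the frame of \<open>S3\<close> moves with the point.
\<close>

lemma frechet_derivative_basis_sum:
  fixes f :: "'a::euclidean_space \<Rightarrow> 'b::real_normed_vector"
  assumes "f differentiable at x"
  shows "frechet_derivative f (at x) v = (\<Sum>b\<in>Basis. (v \<bullet> b) *\<^sub>R frechet_derivative f (at x) b)"
proof -
  interpret linear "frechet_derivative f (at x)"
    by (rule linear_frechet_derivative[OF assms])
  have "frechet_derivative f (at x) v = frechet_derivative f (at x) (\<Sum>b\<in>Basis. (v \<bullet> b) *\<^sub>R b)"
    by (simp add: euclidean_representation)
  then show ?thesis by (simp add: sum scaleR)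
qed

lemma continuous_on_frechet_derivative:
  fixes f :: "'a::euclidean_space \<Rightarrow> 'b::real_normed_vector" and z v :: "'c::topological_space \<Rightarrow> 'a"
  assumes "Ck_on (Suc k) f S" "continuous_on T z" "continuous_on T v" "\<And>p. p \<in> T \<Longrightarrow> z p \<in> S"
  shows "continuous_on T (\<lambda>p. frechet_derivative f (at (z p)) (v p))"
proof -
  have c: "continuous_on T (\<lambda>p. frechet_derivative f (at (z p)) b)" for b
    by (rule continuous_on_compose2[of S "\<lambda>x. frechet_derivative f (at x) b"])
       (use assms in \<open>auto intro: Ck_on_imp_continuous_on\<close>)
  have "continuous_on T (\<lambda>p. \<Sum>b\<in>Basis. (v p \<bullet> b) *\<^sub>R frechet_derivative f (at (z p)) b)"
    by (intro continuous_intros assms c)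
  then show ?thesis
    by (rule continuous_on_eq) (use assms in \<open>auto simp: frechet_derivative_basis_sum[symmetric]\<close>)
qed

lemma frechet_derivative2_basis_sum:
  fixes f :: "'a::euclidean_space \<Rightarrow> 'b::real_normed_vector"
  assumes "Ck_on (Suc (Suc k)) f S" "open S" "x \<in> S"
  shows "frechet_derivative (\<lambda>y. frechet_derivative f (at y) v) (at x) w =
    (\<Sum>b\<in>Basis. (v \<bullet> b) *\<^sub>R frechet_derivative (\<lambda>y. frechet_derivative f (at y) b) (at x) w)"
proof -
  have "((\<lambda>y. \<Sum>b\<in>Basis. (v \<bullet> b) *\<^sub>R frechet_derivative f (at y) b) has_derivative
    (\<lambda>w. \<Sum>b\<in>Basis. (v \<bullet> b) *\<^sub>R frechet_derivative (\<lambda>y. frechet_derivative f (at y) b) (at x) w)) (at x)"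
    by (intro has_derivative_sum has_derivative_scaleR_right)
       (rule Ck_on_Suc_has_derivative[OF Ck_on_Suc_deriv[OF assms(1)] assms(3)])
  then have "((\<lambda>y. frechet_derivative f (at y) v) has_derivative
    (\<lambda>w. \<Sum>b\<in>Basis. (v \<bullet> b) *\<^sub>R frechet_derivative (\<lambda>y. frechet_derivative f (at y) b) (at x) w)) (at x)"
    by (rule has_derivative_transform_within_open[OF _ assms(2,3)])
       (use assms(1) in \<open>simp add: frechet_derivative_basis_sum[symmetric]\<close>)
  then show ?thesis by (rule frechet_derivative_at[symmetric, THEN fun_cong])
qed

lemma continuous_on_frechet_derivative2:
  fixes f :: "'a::euclidean_space \<Rightarrow> 'b::real_normed_vector" and z v w :: "'c::topological_space \<Rightarrow> 'a"
  assumes "Ck_on (Suc (Suc k)) f S" "open S"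
    and "continuous_on T z" "continuous_on T v" "continuous_on T w" "\<And>p. p \<in> T \<Longrightarrow> z p \<in> S"
  shows "continuous_on T (\<lambda>p. frechet_derivative (\<lambda>y. frechet_derivative f (at y) (v p)) (at (z p)) (w p))"
proof -
  have c: "continuous_on T (\<lambda>p. frechet_derivative (\<lambda>y. frechet_derivative f (at y) b) (at (z p)) (w p))" for b
    by (rule continuous_on_frechet_derivative[OF Ck_on_Suc_deriv[OF assms(1)]]) (use assms in auto)
  have "continuous_on T (\<lambda>p. \<Sum>b\<in>Basis. (v p \<bullet> b) *\<^sub>R
     frechet_derivative (\<lambda>y. frechet_derivative f (at y) b) (at (z p)) (w p))"
    by (intro continuous_intros assms c)
  then show ?thesis
    by (rule continuous_on_eq) (use assms in \<open>auto simp: frechet_derivative2_basis_sum[OF assms(1,2), symmetric]\<close>)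
qed

lemma has_vector_derivative_along_line:
  fixes f :: "'a::real_normed_vector \<Rightarrow> 'b::real_normed_vector"
  assumes "(f has_derivative f') (at (c + t *\<^sub>R v))"
  shows "((\<lambda>s. f (c + s *\<^sub>R v)) has_vector_derivative f' v) (at t within A)"
proof -
  have "((\<lambda>s. c + s *\<^sub>R v) has_derivative (\<lambda>s. s *\<^sub>R v)) (at t within A)"
    by (auto intro!: derivative_eq_intros)
  from has_derivative_compose[OF this assms]
  show ?thesis
    by (simp add: has_vector_derivative_def linear_scale[OF has_derivative_linear[OF assms]])
qed

text \<open>
  By the fundamental theorem of calculus, the increment of \<open>f\<close> along \<open>v\<close> is the integral of its derivative in
  direction \<open>v\<close>. Differentiating this under the integral sign in direction \<open>w\<close>, and then with respect to the upper
  limit, exhibits the second derivative in the opposite order.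
\<close>

lemma second_derivative_symmetric:
  fixes f :: "'a::euclidean_space \<Rightarrow> 'b::euclidean_space"
  assumes C: "Ck_on (Suc (Suc k)) f S" and S: "open S" "x \<in> S"
  shows "frechet_derivative (\<lambda>y. frechet_derivative f (at y) v) (at x) w =
         frechet_derivative (\<lambda>y. frechet_derivative f (at y) w) (at x) v"
proof -
  define D where "D u y = frechet_derivative f (at y) u" for u y
  define DD where "DD u y u' = frechet_derivative (D u) (at y) u'" for u y u'
  have D: "(f has_derivative (\<lambda>u. D u y)) (at y)" if "y \<in> S" for y
    using Ck_on_Suc_has_derivative[OF C that] by (simp add: D_def)
  have DD: "(D u has_derivative DD u y) (at y)" if "y \<in> S" for y u
    using Ck_on_Suc_has_derivative[OF Ck_on_Suc_deriv[OF C] that] by (simp add: D_def[abs_def] DD_def[abs_def])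
  have cD: "continuous_on S (D u)" for u
    using Ck_on_imp_continuous_on[OF Ck_on_Suc_deriv[OF C]] by (simp add: D_def[abs_def])
  have cDD: "continuous_on S (\<lambda>y. DD u y u')" for u u'
    using Ck_on_imp_continuous_on[OF Ck_on_Suc_deriv[OF Ck_on_Suc_deriv[OF C]]]
    by (simp add: D_def[abs_def] DD_def[abs_def])
  \<comment> \<open>A parallelogram around \<open>x\<close>, spanned by multiples of \<open>v\<close> and \<open>w\<close>, that stays inside \<open>S\<close>.\<close>
  obtain e where e: "e > 0" "ball x e \<subseteq> S"
    using S by (meson open_contains_ball)
  define d where "d = e / (norm v + norm w + 1)"
  define z where "z s t = x + s *\<^sub>R v + t *\<^sub>R w" for s t
  have n: "norm v + norm w + 1 > 0" by (simp add: add_nonneg_pos)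
  have d: "d > 0" using e n by (simp add: d_def)
  have zS: "z s t \<in> S" if "\<bar>s\<bar> \<le> d" "\<bar>t\<bar> \<le> d" for s t
  proof -
    have "norm (s *\<^sub>R v + t *\<^sub>R w) \<le> \<bar>s\<bar> * norm v + \<bar>t\<bar> * norm w"
      by (rule norm_triangle_le) simp
    also have "\<dots> \<le> d * norm v + d * norm w"
      using that by (intro add_mono mult_right_mono) auto
    also have "\<dots> < d * (norm v + norm w + 1)"
      using d by (simp add: algebra_simps)
    also have "\<dots> = e" using n by (simp add: d_def)
    finally have "dist x (z s t) < e" by (simp add: z_def dist_norm norm_minus_commute ac_simps)
    then show ?thesis using e by auto
  qed
  have contz: "continuous_on T (\<lambda>p. z (a p) (b p))"
    if "continuous_on T a" "continuous_on T b" for T :: "'c::topological_space set" and a b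
    unfolding z_def by (intro continuous_intros that)
  let ?U = "{-d<..<d}"
  have in_s: "((\<lambda>s. g (z s t)) has_vector_derivative g' v) (at s within A)"
    if "(g has_derivative g') (at (z s t))" for g :: "'a \<Rightarrow> 'b" and g' s t A
    using has_vector_derivative_along_line[of g g' "x + t *\<^sub>R w" s v A] that
    by (simp add: z_def algebra_simps)
  have in_t: "((\<lambda>t. g (z s t)) has_vector_derivative g' w) (at t within A)"
    if "(g has_derivative g') (at (z s t))" for g :: "'a \<Rightarrow> 'b" and g' s t A
    using has_vector_derivative_along_line[of g g' "x + s *\<^sub>R v" t w A] that
    by (simp add: z_def algebra_simps)
  \<comment> \<open>Differentiate \<open>\<integral> D v (z s t) ds = f (z r t) - f (z 0 t)\<close> at \<open>t = 0\<close> on both sides.\<close>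
  have key: "integral {0..r} (\<lambda>s. DD v (z s 0) w) = D w (z r 0) - D w (z 0 0)" if r: "r \<in> {0..d}" for r
  proof -
    have ftc: "integral (cbox 0 r) (\<lambda>s. D v (z s t)) = f (z r t) - f (z 0 t)" if "t \<in> ?U" for t
    proof -
      have "((\<lambda>s. D v (z s t)) has_integral f (z r t) - f (z 0 t)) {0..r}"
        by (rule fundamental_theorem_of_calculus) (use r that in \<open>auto intro!: in_s D zS\<close>)
      then show ?thesis by (simp add: integral_unique)
    qed
    have "((\<lambda>t. integral (cbox 0 r) (\<lambda>s. D v (z s t))) has_vector_derivative
       integral (cbox 0 r) (\<lambda>s. DD v (z s 0) w)) (at 0 within ?U)"
    proof (rule leibniz_rule_vector_derivative)
      show "((\<lambda>t. D v (z s t)) has_vector_derivative DD v (z s t) w) (at t within ?U)"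
        if "t \<in> ?U" "s \<in> cbox 0 r" for t s
        by (rule in_t, rule DD, rule zS) (use that r in auto)
      show "(\<lambda>s. D v (z s t)) integrable_on cbox 0 r" if "t \<in> ?U" for t
        by (rule integrable_continuous, rule continuous_on_compose2[OF cD])
           (use that r in \<open>auto intro!: contz continuous_intros zS\<close>)
      show "continuous_on (?U \<times> cbox 0 r) (\<lambda>(t, s). DD v (z s t) w)"
        unfolding case_prod_beta
        by (rule continuous_on_compose2[OF cDD])
           (use r in \<open>auto intro!: contz continuous_intros zS\<close>)
    qed (use d in auto)
    then have "((\<lambda>t. f (z r t) - f (z 0 t)) has_vector_derivative
       integral (cbox 0 r) (\<lambda>s. DD v (z s 0) w)) (at 0 within ?U)"
      by (rule has_vector_derivative_transform[rotated 2]) (use d in \<open>auto simp: ftc[simplified]\<close>)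
    moreover have "((\<lambda>t. f (z r t) - f (z 0 t)) has_vector_derivative (D w (z r 0) - D w (z 0 0))) (at 0 within ?U)"
      by (intro has_vector_derivative_diff in_t D zS) (use r d in auto)
    ultimately have "integral (cbox 0 r) (\<lambda>s. DD v (z s 0) w) = D w (z r 0) - D w (z 0 0)"
      using d by (intro vector_derivative_unique_within[of 0 ?U]) (auto simp: at_within_open[of 0 ?U])
    then show ?thesis by simp
  qed
  have "((\<lambda>r. integral {0..r} (\<lambda>s. DD v (z s 0) w)) has_vector_derivative DD v (z 0 0) w) (at 0 within {0..d})"
    by (rule integral_has_vector_derivative, rule continuous_on_compose2[OF cDD])
       (use d in \<open>auto intro!: contz continuous_intros zS\<close>)
  then have "((\<lambda>r. D w (z r 0) - D w (z 0 0)) has_vector_derivative DD v (z 0 0) w) (at 0 within {0..d})"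
    by (rule has_vector_derivative_transform[rotated 2]) (use d key in auto)
  moreover have "((\<lambda>r. D w (z r 0) - D w (z 0 0)) has_vector_derivative DD w (z 0 0) v - 0) (at 0 within {0..d})"
    by (intro has_vector_derivative_diff in_s DD zS has_vector_derivative_const) (use d in auto)
  ultimately have "DD v (z 0 0) w = DD w (z 0 0) v"
    using d vector_derivative_unique_within_closed_interval[of 0 d 0] by auto
  then show ?thesis by (simp add: z_def D_def[abs_def] DD_def)
qed

section \<open>Forms and derivatives on the sphere\<close>

lemma S3_nonzero: "x \<in> S3 \<Longrightarrow> x \<noteq> 0"
  by (auto simp: S3_def)

lemma sgn_S3: "x \<in> S3 \<Longrightarrow> sgn x = x"
  by (simp add: S3_def sgn_div_norm)

lemma sgn_in_S3: "y \<noteq> 0 \<Longrightarrow> sgn y \<in> S3"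
  by (simp add: S3_def norm_sgn)

lemma S3_components: "x \<in> S3 \<Longrightarrow> (x$1)\<^sup>2 + (x$2)\<^sup>2 + (x$3)\<^sup>2 + (x$4)\<^sup>2 = 1"
  by (simp add: S3_def norm_eq_1 inner_vec_def sum_4 power2_eq_square)

lemma frechet_derivative_sgn:
  fixes y :: "real^4"
  assumes "y \<noteq> 0"
  shows "frechet_derivative sgn (at y) v = (1 / norm y) *\<^sub>R (v - (sgn y \<bullet> v) *\<^sub>R sgn y)"
  using fun_cong[OF frechet_derivative_at[OF sgn_has_derivative[OF assms], symmetric]] .

lemma frechet_derivative_sgn_tangent:
  fixes y :: "real^4"
  assumes "y \<noteq> 0"
  shows "frechet_derivative sgn (at y) v \<in> tangent (sgn y)"
  using assms
  by (simp add: frechet_derivative_sgn tangent_def inner_diff_left inner_diff_right dot_square_norm norm_sgn inner_commute)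

lemma frechet_derivative_sgn_S3:
  assumes "x \<in> S3"
  shows "frechet_derivative sgn (at x) v = v - (x \<bullet> v) *\<^sub>R x"
  using assms S3_nonzero[OF assms] by (simp add: frechet_derivative_sgn sgn_S3) (simp add: S3_def)

text \<open>
  The derivative of the retraction \<open>sgn\<close> at a point of the sphere is the projection onto the tangent space.
\<close>

lemma radial_pullback_S3:
  "x \<in> S3 \<Longrightarrow> v \<in> tangent x \<Longrightarrow> radial_pullback \<alpha> x v = \<alpha> x v"
  by (simp add: radial_pullback_def frechet_derivative_sgn_S3 sgn_S3 tangent_def inner_commute)

lemma frame_expansion:
  assumes "x \<in> S3" "u \<in> tangent x"
  shows "u = (u \<bullet> \<xi> x) *\<^sub>R \<xi> x + (u \<bullet> X1 x) *\<^sub>R X1 x + (u \<bullet> X2 x) *\<^sub>R X2 x"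
proof -
  have n: "x$1*x$1 + x$2*x$2 + x$3*x$3 + x$4*x$4 = 1"
    using S3_components[OF assms(1)] by (simp add: power2_eq_square)
  have t: "u$1*x$1 + u$2*x$2 + u$3*x$3 + u$4*x$4 = 0"
    using assms(2) by (simp add: tangent_def inner_vec_def sum_4)
  show ?thesis
    unfolding vec_eq_iff forall_4 \<xi>_def X1_def X2_def inner_vec_def sum_4
    apply simp
    apply (intro conjI)
    using n t by algebra+
qed

text \<open>
  The regularity that Stokes' theorem needs. It asks for one derivative only, which for the form
  \<open>\<omega>(W, d\<phi>)\<close> of a variation is a single application of the product rule.
\<close>

definition C1_form :: "form1 \<Rightarrow> bool" where
  "C1_form \<alpha> \<longleftrightarrow>
     (\<forall>x\<in>S3. \<exists>L. linear L \<and> (\<forall>v\<in>tangent x. \<alpha> x v = L v)) \<and>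
     (\<forall>v. Ck_on (Suc 0) (\<lambda>y. radial_pullback \<alpha> y v) (- {0}))"

lemma smooth_form1_imp_C1: "smooth_form1 \<alpha> \<Longrightarrow> C1_form \<alpha>"
  unfolding smooth_form1_def smooth_on_def C1_form_def by blast

lemma linear_radial_pullback:
  assumes "C1_form \<alpha>" "y \<noteq> 0"
  shows "linear (radial_pullback \<alpha> y)"
proof -
  obtain L where L: "linear L" "\<And>v. v \<in> tangent (sgn y) \<Longrightarrow> \<alpha> (sgn y) v = L v"
    using assms sgn_in_S3[OF assms(2)] unfolding C1_form_def by blast
  have "radial_pullback \<alpha> y = L \<circ> frechet_derivative sgn (at y)"
    by (simp add: fun_eq_iff radial_pullback_def L(2) frechet_derivative_sgn_tangent assms)
  moreover have "linear (frechet_derivative (sgn :: real^4 \<Rightarrow> _) (at y))"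
    by (rule linear_frechet_derivative) (use sgn_has_derivative[OF assms(2)] in \<open>rule differentiableI\<close>)
  ultimately show ?thesis using L(1) by (simp add: linear_compose)
qed

lemma radial_pullback_basis_sum:
  assumes "C1_form \<alpha>" "y \<noteq> 0"
  shows "radial_pullback \<alpha> y v = (\<Sum>b\<in>Basis. (v \<bullet> b) * radial_pullback \<alpha> y b)"
proof -
  interpret linear "radial_pullback \<alpha> y" by (rule linear_radial_pullback[OF assms])
  have "radial_pullback \<alpha> y v = radial_pullback \<alpha> y (\<Sum>b\<in>Basis. (v \<bullet> b) *\<^sub>R b)"
    by (simp add: euclidean_representation)
  then show ?thesis by (simp add: sum scaleR)
qed

lemma radial_pullback_has_derivative:
  assumes "C1_form \<alpha>" "y \<noteq> 0"
  shows "((\<lambda>y. radial_pullback \<alpha> y v) has_derivative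
    frechet_derivative (\<lambda>y. radial_pullback \<alpha> y v) (at y)) (at y)"
  using Ck_on_Suc_has_derivative[of 0 "\<lambda>y. radial_pullback \<alpha> y v" "- {0}" y] assms
  by (auto simp: C1_form_def)

lemma radial_pullback_deriv_basis_sum:
  assumes "C1_form \<alpha>" "y \<noteq> 0"
  shows "frechet_derivative (\<lambda>y. radial_pullback \<alpha> y v) (at y) w =
    (\<Sum>b\<in>Basis. (v \<bullet> b) * frechet_derivative (\<lambda>y. radial_pullback \<alpha> y b) (at y) w)"
proof -
  have "((\<lambda>y. \<Sum>b\<in>Basis. (v \<bullet> b) * radial_pullback \<alpha> y b) has_derivative
    (\<lambda>w. \<Sum>b\<in>Basis. (v \<bullet> b) * frechet_derivative (\<lambda>y. radial_pullback \<alpha> y b) (at y) w)) (at y)"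
    by (intro has_derivative_sum has_derivative_mult_right radial_pullback_has_derivative assms)
  then have "((\<lambda>y. radial_pullback \<alpha> y v) has_derivative
    (\<lambda>w. \<Sum>b\<in>Basis. (v \<bullet> b) * frechet_derivative (\<lambda>y. radial_pullback \<alpha> y b) (at y) w)) (at y)"
    by (rule has_derivative_transform_within_open[where s="- {0}"])
       (use assms in \<open>auto simp: radial_pullback_basis_sum[OF assms(1), symmetric]\<close>)
  then show ?thesis by (rule frechet_derivative_at[symmetric, THEN fun_cong])
qed

lemma linear_radial_pullback_deriv:
  assumes "C1_form \<alpha>" "y \<noteq> 0"
  shows "linear (\<lambda>v. frechet_derivative (\<lambda>y. radial_pullback \<alpha> y v) (at y) w)"
proof -
  have "linear (\<lambda>v. \<Sum>b\<in>Basis. (v \<bullet> b) * frechet_derivative (\<lambda>y. radial_pullback \<alpha> y b) (at y) w)"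
    by (rule linearI) (simp_all add: inner_add_left algebra_simps sum.distrib sum_distrib_left)
  then show ?thesis
    by (subst radial_pullback_deriv_basis_sum[OF assms])
qed

lemma bilinear_ext_deriv:
  assumes "C1_form \<alpha>" "x \<in> S3"
  shows "bilinear (ext_deriv \<alpha> x)"
proof -
  note x = S3_nonzero[OF assms(2)]
  have 1: "linear (\<lambda>v. frechet_derivative (\<lambda>y. radial_pullback \<alpha> y v) (at x) w)" for w
    by (rule linear_radial_pullback_deriv[OF assms(1) x])
  have 2: "linear (\<lambda>w. frechet_derivative (\<lambda>y. radial_pullback \<alpha> y v) (at x) w)" for v
    using has_derivative_linear[OF radial_pullback_has_derivative[OF assms(1) x]] by simp
  show ?thesis
    unfolding bilinear_def ext_deriv_def by (intro conjI allI linear_compose_sub 1 2)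
qed

lemma ext_deriv_self: "ext_deriv \<alpha> x v v = 0"
  by (simp add: ext_deriv_def)

text \<open>
  The product rule for a form evaluated on a moving vector at a moving point. It applies with \<open>y\<close> and \<open>v\<close> the
  coordinate map of \<open>S3\<close> and one of its partial derivatives, along a coordinate line.
\<close>

lemma radial_pullback_along_curve:
  assumes \<alpha>: "C1_form \<alpha>" and nz: "\<And>t. y t \<noteq> 0"
    and y: "(y has_vector_derivative y') (at t within T)"
    and v: "(v has_vector_derivative v') (at t within T)"
  shows "((\<lambda>t. radial_pullback \<alpha> (y t) (v t)) has_real_derivative
    frechet_derivative (\<lambda>y. radial_pullback \<alpha> y (v t)) (at (y t)) y' + radial_pullback \<alpha> (y t) v') (at t within T)"
proof -
  let ?D = "\<lambda>b. frechet_derivative (\<lambda>y. radial_pullback \<alpha> y b) (at (y t))"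
  have 1: "((\<lambda>t. radial_pullback \<alpha> (y t) b) has_real_derivative ?D b y') (at t within T)" for b
  proof -
    note d = radial_pullback_has_derivative[OF \<alpha> nz, of b t]
    have "((\<lambda>t. radial_pullback \<alpha> (y t) b) has_derivative (\<lambda>h. ?D b (h *\<^sub>R y'))) (at t within T)"
      using has_derivative_compose[OF y[unfolded has_vector_derivative_def] d] .
    then show ?thesis
      by (simp add: has_field_derivative_def linear_scale[OF has_derivative_linear[OF d]] mult_commute_abs)
  qed
  have 2: "((\<lambda>t. v t \<bullet> b) has_real_derivative v' \<bullet> b) (at t within T)" for b
    using bounded_linear.has_vector_derivative[OF bounded_linear_inner_left v]
    by (simp add: has_real_derivative_iff_has_vector_derivative)
  have "((\<lambda>t. \<Sum>b\<in>Basis. (v t \<bullet> b) * radial_pullback \<alpha> (y t) b) has_real_derivative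
     (\<Sum>b\<in>Basis. (v' \<bullet> b) * radial_pullback \<alpha> (y t) b + ?D b y' * (v t \<bullet> b))) (at t within T)"
    by (intro DERIV_sum DERIV_mult 1 2)
  moreover have "(\<Sum>b\<in>Basis. (v' \<bullet> b) * radial_pullback \<alpha> (y t) b + ?D b y' * (v t \<bullet> b)) =
      ?D (v t) y' + radial_pullback \<alpha> (y t) v'"
    by (subst radial_pullback_deriv_basis_sum[OF \<alpha> nz], subst (2) radial_pullback_basis_sum[OF \<alpha> nz])
       (simp add: sum.distrib mult.commute)
  ultimately show ?thesis
    by (simp add: radial_pullback_basis_sum[OF \<alpha> nz, symmetric])
qed

lemma continuous_on_radial_pullback:
  assumes \<alpha>: "C1_form \<alpha>" and "continuous_on T y" "continuous_on T v" and nz: "\<And>t. t \<in> T \<Longrightarrow> y t \<noteq> 0"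
  shows "continuous_on T (\<lambda>t. radial_pullback \<alpha> (y t) (v t))"
proof -
  have 1: "continuous_on T (\<lambda>t. radial_pullback \<alpha> (y t) b)" for b
  proof (rule continuous_on_compose2[of "- {0}" "\<lambda>y. radial_pullback \<alpha> y b"])
    show "continuous_on (- {0}) (\<lambda>y. radial_pullback \<alpha> y b)"
      by (rule Ck_on_imp_continuous_on[of "Suc 0"]) (use \<alpha> in \<open>simp add: C1_form_def\<close>)
  qed (use assms in auto)
  have "continuous_on T (\<lambda>t. \<Sum>b\<in>Basis. (v t \<bullet> b) * radial_pullback \<alpha> (y t) b)"
    by (intro continuous_intros assms 1)
  then show ?thesis
    by (rule continuous_on_eq) (simp add: radial_pullback_basis_sum[OF \<alpha> nz, symmetric])
qed

lemma continuous_on_radial_pullback_deriv: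
  assumes \<alpha>: "C1_form \<alpha>" and "continuous_on T y" "continuous_on T v" "continuous_on T w"
    and nz: "\<And>t. t \<in> T \<Longrightarrow> y t \<noteq> 0"
  shows "continuous_on T (\<lambda>t. frechet_derivative (\<lambda>y. radial_pullback \<alpha> y (v t)) (at (y t)) (w t))"
proof -
  have 1: "continuous_on T (\<lambda>t. frechet_derivative (\<lambda>y. radial_pullback \<alpha> y b) (at (y t)) (w t))" for b
    by (rule continuous_on_frechet_derivative[of 0 _ "- {0}"])
       (use assms in \<open>auto simp: C1_form_def\<close>)
  have "continuous_on T (\<lambda>t. \<Sum>b\<in>Basis. (v t \<bullet> b) * frechet_derivative (\<lambda>y. radial_pullback \<alpha> y b) (at (y t)) (w t))"
    by (intro continuous_intros assms 1)
  then show ?thesis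
    by (rule continuous_on_eq) (simp add: radial_pullback_deriv_basis_sum[OF \<alpha> nz, symmetric])
qed

text \<open>
  The left side is the wedge product of a linear form and an alternating bilinear one, an alternating trilinear
  form on a space of dimension 3. Hence it is the determinant in the frame times its value on the frame.
\<close>

lemma wedge_frame:
  assumes A: "linear A" and B: "bilinear B" "\<And>v. B v v = (0::real)"
    and x: "x \<in> S3" "u \<in> tangent x" "v \<in> tangent x" "w \<in> tangent x"
  defines "c \<equiv> \<lambda>u. u \<bullet> \<xi> x" and "c1 \<equiv> \<lambda>u. u \<bullet> X1 x" and "c2 \<equiv> \<lambda>u. u \<bullet> X2 x"
  shows "A u * B v w + A v * B w u + A w * B u v =
    (A (\<xi> x) * B (X1 x) (X2 x) + A (X1 x) * B (X2 x) (\<xi> x) + A (X2 x) * B (\<xi> x) (X1 x)) *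
    (c u * (c1 v * c2 w - c2 v * c1 w) + c1 u * (c2 v * c w - c v * c2 w) + c2 u * (c v * c1 w - c1 v * c w))"
proof -
  have B_skew: "B p q = - B q p" for p q
    using B(2)[of "p + q"] B(2)[of p] B(2)[of q]
    by (simp add: bilinear_ladd[OF B(1)] bilinear_radd[OF B(1)])
  have e: "u = c u *\<^sub>R \<xi> x + c1 u *\<^sub>R X1 x + c2 u *\<^sub>R X2 x"
    "v = c v *\<^sub>R \<xi> x + c1 v *\<^sub>R X1 x + c2 v *\<^sub>R X2 x"
    "w = c w *\<^sub>R \<xi> x + c1 w *\<^sub>R X1 x + c2 w *\<^sub>R X2 x"
    unfolding c_def c1_def c2_def by (rule frame_expansion; fact)+
  have Ae: "A p = P * A (\<xi> x) + Q * A (X1 x) + R * A (X2 x)"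
    if "p = P *\<^sub>R \<xi> x + Q *\<^sub>R X1 x + R *\<^sub>R X2 x" for p P Q R
    using A by (simp add: that linear_add linear_scale)
  have Be: "B p q = (P * Q' - Q * P') * B (\<xi> x) (X1 x) + (Q * R' - R * Q') * B (X1 x) (X2 x)
      + (R * P' - P * R') * B (X2 x) (\<xi> x)"
    if "p = P *\<^sub>R \<xi> x + Q *\<^sub>R X1 x + R *\<^sub>R X2 x" "q = P' *\<^sub>R \<xi> x + Q' *\<^sub>R X1 x + R' *\<^sub>R X2 x"
    for p q P Q R P' Q' R'
  proof -
    have "B p q = P * (P' * B (\<xi> x) (\<xi> x) + Q' * B (\<xi> x) (X1 x) + R' * B (\<xi> x) (X2 x))
       + Q * (P' * B (X1 x) (\<xi> x) + Q' * B (X1 x) (X1 x) + R' * B (X1 x) (X2 x))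
       + R * (P' * B (X2 x) (\<xi> x) + Q' * B (X2 x) (X1 x) + R' * B (X2 x) (X2 x))"
      by (simp add: that bilinear_ladd[OF B(1)] bilinear_radd[OF B(1)] bilinear_lmul[OF B(1)]
          bilinear_rmul[OF B(1)] algebra_simps)
    then show ?thesis
      using B_skew[of "X1 x" "\<xi> x"] B_skew[of "X2 x" "X1 x"] B_skew[of "\<xi> x" "X2 x"]
      by (simp add: B(2) algebra_simps)
  qed
  show ?thesis
    unfolding Ae[OF e(1)] Ae[OF e(2)] Ae[OF e(3)] Be[OF e(1,2)] Be[OF e(2,3)] Be[OF e(3,1)] by (simp add: algebra_simps)
qed

lemma linear_xi: "linear \<xi>"
  by (rule linearI) (simp_all add: \<xi>_def vec_eq_iff forall_4)

text \<open>
  The volume form is itself such a wedge product, with value 1 on the frame, so it is the determinant above.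
\<close>

lemma wedge_vol:
  assumes A: "linear A" and B: "bilinear B" "\<And>v. B v v = (0::real)"
    and x: "x \<in> S3" "u \<in> tangent x" "v \<in> tangent x" "w \<in> tangent x"
  shows "A u * B v w + A v * B w u + A w * B u v =
    (A (\<xi> x) * B (X1 x) (X2 x) + A (X1 x) * B (X2 x) (\<xi> x) + A (X2 x) * B (\<xi> x) (X1 x)) * vol_form x u v w"
proof -
  \<comment> \<open>Half of \<open>d\<eta>\<close>.\<close>
  define E where "E p q = \<xi> p \<bullet> q" for p q
  have E: "bilinear E" "\<And>v. E v v = 0"
    using linear_add[OF linear_xi] linear_scale[OF linear_xi]
    by (auto simp: bilinear_def E_def inner_add inner_commute intro!: linearI)
       (simp add: \<xi>_def inner_vec_def sum_4)
  have L: "linear (\<lambda>p. \<xi> x \<bullet> p)" by (rule linearI) (simp_all add: inner_add_right)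
  have v: "vol_form x u v w = (\<xi> x \<bullet> u) * E v w + (\<xi> x \<bullet> v) * E w u + (\<xi> x \<bullet> w) * E u v"
    if "u \<in> tangent x" "v \<in> tangent x" "w \<in> tangent x" for u v w
    using that x(1) by (simp add: vol_form_def wedge12_def \<eta>_def ext_deriv_\<eta> E_def)
  have 1: "(\<xi> x \<bullet> \<xi> x) * E (X1 x) (X2 x) + (\<xi> x \<bullet> X1 x) * E (X2 x) (\<xi> x) + (\<xi> x \<bullet> X2 x) * E (\<xi> x) (X1 x) = 1"
    using vol_form_frame[OF x(1)] by (simp add: v frame_tangent)
  show ?thesis
    unfolding v[OF x(2-)] wedge_frame[OF L E x] 1 by (simp add: wedge_frame[OF A B x])
qed

lemma wedge12_ext_deriv_vol:
  assumes "C1_form \<alpha>" "C1_form \<beta>" "x \<in> S3" "u \<in> tangent x" "v \<in> tangent x" "w \<in> tangent x"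
  shows "wedge12 \<alpha> (ext_deriv \<beta>) x u v w =
    wedge12 \<alpha> (ext_deriv \<beta>) x (\<xi> x) (X1 x) (X2 x) * vol_form x u v w"
  using wedge_vol[OF linear_radial_pullback[OF assms(1) S3_nonzero[OF assms(3)]]
    bilinear_ext_deriv[OF assms(2,3)] ext_deriv_self assms(3-)]
  by (simp add: wedge12_def radial_pullback_S3 assms frame_tangent)

section \<open>Stokes' theorem on the 3-sphere\<close>

text \<open>
  The partial derivatives of \<open>S3_coords\<close> and their mixed second partial derivatives; the one with respect to \<open>a\<close>
  and \<open>b\<close> vanishes.
\<close>

definition coord_s :: "real \<times> real \<times> real \<Rightarrow> real^4" where
  "coord_s = (\<lambda>(s, a, b). vector [cos s * cos a, cos s * sin a, - sin s * cos b, - sin s * sin b])"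

definition coord_a :: "real \<times> real \<times> real \<Rightarrow> real^4" where
  "coord_a = (\<lambda>(s, a, b). vector [- sin s * sin a, sin s * cos a, 0, 0])"

definition coord_b :: "real \<times> real \<times> real \<Rightarrow> real^4" where
  "coord_b = (\<lambda>(s, a, b). vector [0, 0, - cos s * sin b, cos s * cos b])"

definition coord_sa :: "real \<times> real \<times> real \<Rightarrow> real^4" where
  "coord_sa = (\<lambda>(s, a, b). vector [- cos s * sin a, cos s * cos a, 0, 0])"

definition coord_sb :: "real \<times> real \<times> real \<Rightarrow> real^4" where
  "coord_sb = (\<lambda>(s, a, b). vector [0, 0, sin s * sin b, - sin s * cos b])"

lemmas coord_defs = S3_coords_def coord_s_def coord_a_def coord_b_def coord_sa_def coord_sb_def

lemma has_derivative_vec: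
  fixes f f' :: "_ \<Rightarrow> real^'n"
  assumes "\<And>i. ((\<lambda>x. f x $ i) has_derivative (\<lambda>h. f' h $ i)) F"
  shows "(f has_derivative f') F"
proof -
  have "((\<lambda>x. \<Sum>i\<in>UNIV. (f x $ i) *\<^sub>R axis i 1 :: real^'n) has_derivative (\<lambda>h. \<Sum>i\<in>UNIV. (f' h $ i) *\<^sub>R axis i 1)) F"
    by (intro has_derivative_sum has_derivative_scaleR_left assms)
  moreover have "(\<Sum>i\<in>UNIV. (z $ i) *\<^sub>R axis i 1) = z" for z :: "real^'n"
    by (simp add: vec_eq_iff axis_def if_distrib[of "\<lambda>c. _ * c"] cong: if_cong)
  ultimately show ?thesis by simp
qed

lemma has_vector_derivative_vec4:
  fixes f :: "real \<Rightarrow> real^4"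
  assumes "\<forall>i. ((\<lambda>x. f x $ i) has_real_derivative f' $ i) (at t within T)"
  shows "(f has_vector_derivative f') (at t within T)"
  unfolding has_vector_derivative_def
  by (rule has_derivative_vec) (use assms in \<open>auto simp: has_field_derivative_def mult_commute_abs\<close>)

lemma S3_coords_has_derivative:
  "(S3_coords has_derivative (\<lambda>h. fst h *\<^sub>R coord_s q + fst (snd h) *\<^sub>R coord_a q + snd (snd h) *\<^sub>R coord_b q)) (at q)"
proof (rule has_derivative_vec)
  obtain s a b where q: "q = (s, a, b)" by (cases q)
  fix i :: 4
  have "\<forall>i. ((\<lambda>x. S3_coords x $ i) has_derivative
     (\<lambda>h. (fst h *\<^sub>R coord_s q + fst (snd h) *\<^sub>R coord_a q + snd (snd h) *\<^sub>R coord_b q) $ i)) (at q)"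
    unfolding forall_4 coord_defs case_prod_beta q
    by (intro conjI; simp; auto intro!: derivative_eq_intros simp: fun_eq_iff algebra_simps)
  then show "((\<lambda>x. S3_coords x $ i) has_derivative
     (\<lambda>h. (fst h *\<^sub>R coord_s q + fst (snd h) *\<^sub>R coord_a q + snd (snd h) *\<^sub>R coord_b q) $ i)) (at q)" ..
qed

lemma S3_integral_coords:
  "S3_integral \<Theta> = integral (cbox (0, 0, 0) (pi/2, 2*pi, 2*pi))
     (\<lambda>q. \<Theta> (S3_coords q) (coord_s q) (coord_a q) (coord_b q))"
  unfolding S3_integral_def
  by (simp add: frechet_derivative_at[OF S3_coords_has_derivative, symmetric])

lemma S3_coords_in_S3: "S3_coords q \<in> S3"
proof -
  obtain s a b where q: "q = (s, a, b)" by (cases q)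
  have "(sin s * cos a)\<^sup>2 + (sin s * sin a)\<^sup>2 + (cos s * cos b)\<^sup>2 + (cos s * sin b)\<^sup>2 =
     (sin s)\<^sup>2 * ((sin a)\<^sup>2 + (cos a)\<^sup>2) + (cos s)\<^sup>2 * ((sin b)\<^sup>2 + (cos b)\<^sup>2)"
    by algebra
  also have "\<dots> = 1" by (simp only: sin_cos_squared_add) simp
  finally show ?thesis
    by (simp add: q S3_def norm_eq_1 inner_vec_def sum_4 S3_coords_def power2_eq_square)
qed

lemma coord_tangent:
  "coord_s q \<in> tangent (S3_coords q)" "coord_a q \<in> tangent (S3_coords q)" "coord_b q \<in> tangent (S3_coords q)"
proof -
  obtain s a b where q: "q = (s, a, b)" by (cases q)
  have "cos s * cos a * (sin s * cos a) + cos s * sin a * (sin s * sin a)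
      + (- sin s * cos b) * (cos s * cos b) + (- sin s * sin b) * (cos s * sin b) =
     sin s * cos s * (((sin a)\<^sup>2 + (cos a)\<^sup>2) - ((sin b)\<^sup>2 + (cos b)\<^sup>2))"
    by algebra
  then show "coord_s q \<in> tangent (S3_coords q)" "coord_a q \<in> tangent (S3_coords q)" "coord_b q \<in> tangent (S3_coords q)"
    by (simp_all add: q tangent_def coord_defs inner_vec_def sum_4)
qed

lemma vol_form_coords: "vol_form (S3_coords q) (coord_s q) (coord_a q) (coord_b q) = sin (fst q) * cos (fst q)"
proof -
  obtain s a b where q: "q = (s, a, b)" by (cases q)
  have "(sin s * sin a * (sin s * sin a) + sin s * cos a * (sin s * cos a)) *
      (2 * (cos s * cos b * (sin s * cos b)) + 2 * (cos s * sin b * (sin s * sin b))) +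
      (cos s * sin b * (cos s * sin b) + cos s * cos b * (cos s * cos b)) *
      (2 * (cos s * sin a * (sin s * sin a)) + 2 * (cos s * cos a * (sin s * cos a))) =
      2 * (sin s * cos s) * (((sin s)\<^sup>2 + (cos s)\<^sup>2) * ((sin a)\<^sup>2 + (cos a)\<^sup>2) * ((sin b)\<^sup>2 + (cos b)\<^sup>2))"
    by algebra
  also have "\<dots> = 2 * (sin s * cos s)"
    by (simp only: sin_cos_squared_add mult_1 mult_1_right)
  finally show ?thesis
    apply (simp add: vol_form_def wedge12_def ext_deriv_\<eta> S3_coords_in_S3 coord_tangent)
    apply (simp add: q coord_defs \<eta>_def \<xi>_def inner_vec_def sum_4)
    done
qed

lemma S3_integral_vol:
  assumes "\<And>x u v w. x \<in> S3 \<Longrightarrow> u \<in> tangent x \<Longrightarrow> v \<in> tangent x \<Longrightarrow> w \<in> tangent x \<Longrightarrow>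
     \<Theta> x u v w = f x * vol_form x u v w"
  shows "S3_integral \<Theta> = integral (cbox (0, 0, 0) (pi/2, 2*pi, 2*pi))
     (\<lambda>q. f (S3_coords q) * (sin (fst q) * cos (fst q)))"
  unfolding S3_integral_coords by (simp add: assms S3_coords_in_S3 coord_tangent vol_form_coords)

lemma continuous_on_vec4:
  fixes f :: "'a::topological_space \<Rightarrow> real^4"
  assumes "\<And>i. continuous_on T (\<lambda>x. f x $ i)"
  shows "continuous_on T f"
  using continuous_on_vec_lambda[of T "\<lambda>i x. f x $ i", OF assms] by simp

lemma continuous_coords:
  "continuous_on T S3_coords" "continuous_on T coord_s" "continuous_on T coord_a" "continuous_on T coord_b"
  "continuous_on T coord_sa" "continuous_on T coord_sb"
proof -
  have "\<forall>i. continuous_on T (\<lambda>x. S3_coords x $ i)" "\<forall>i. continuous_on T (\<lambda>x. coord_s x $ i)"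
    "\<forall>i. continuous_on T (\<lambda>x. coord_a x $ i)" "\<forall>i. continuous_on T (\<lambda>x. coord_b x $ i)"
    "\<forall>i. continuous_on T (\<lambda>x. coord_sa x $ i)" "\<forall>i. continuous_on T (\<lambda>x. coord_sb x $ i)"
    unfolding forall_4 coord_defs case_prod_beta by (auto intro!: continuous_intros)
  then show "continuous_on T S3_coords" "continuous_on T coord_s" "continuous_on T coord_a" "continuous_on T coord_b"
    "continuous_on T coord_sa" "continuous_on T coord_sb"
    by (auto intro: continuous_on_vec4)
qed

lemma coord_partial_derivs:
  "((\<lambda>s. S3_coords (s, a, b)) has_vector_derivative coord_s (s, a, b)) (at s within T)"
  "((\<lambda>a. S3_coords (s, a, b)) has_vector_derivative coord_a (s, a, b)) (at a within T)"
  "((\<lambda>b. S3_coords (s, a, b)) has_vector_derivative coord_b (s, a, b)) (at b within T)"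
  "((\<lambda>a. coord_s (s, a, b)) has_vector_derivative coord_sa (s, a, b)) (at a within T)"
  "((\<lambda>b. coord_s (s, a, b)) has_vector_derivative coord_sb (s, a, b)) (at b within T)"
  "((\<lambda>s. coord_a (s, a, b)) has_vector_derivative coord_sa (s, a, b)) (at s within T)"
  "((\<lambda>b. coord_a (s, a, b)) has_vector_derivative 0) (at b within T)"
  "((\<lambda>s. coord_b (s, a, b)) has_vector_derivative coord_sb (s, a, b)) (at s within T)"
  "((\<lambda>a. coord_b (s, a, b)) has_vector_derivative 0) (at a within T)"
proof -
  note * = has_vector_derivative_vec4
  show "((\<lambda>s. S3_coords (s, a, b)) has_vector_derivative coord_s (s, a, b)) (at s within T)"
    by (rule *, unfold forall_4) (auto simp: coord_defs intro!: derivative_eq_intros)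
  show "((\<lambda>a. S3_coords (s, a, b)) has_vector_derivative coord_a (s, a, b)) (at a within T)"
    by (rule *, unfold forall_4) (auto simp: coord_defs intro!: derivative_eq_intros)
  show "((\<lambda>b. S3_coords (s, a, b)) has_vector_derivative coord_b (s, a, b)) (at b within T)"
    by (rule *, unfold forall_4) (auto simp: coord_defs intro!: derivative_eq_intros)
  show "((\<lambda>a. coord_s (s, a, b)) has_vector_derivative coord_sa (s, a, b)) (at a within T)"
    by (rule *, unfold forall_4) (auto simp: coord_defs intro!: derivative_eq_intros)
  show "((\<lambda>b. coord_s (s, a, b)) has_vector_derivative coord_sb (s, a, b)) (at b within T)"
    by (rule *, unfold forall_4) (auto simp: coord_defs intro!: derivative_eq_intros)
  show "((\<lambda>s. coord_a (s, a, b)) has_vector_derivative coord_sa (s, a, b)) (at s within T)"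
    by (rule *, unfold forall_4) (auto simp: coord_defs intro!: derivative_eq_intros)
  show "((\<lambda>b. coord_a (s, a, b)) has_vector_derivative 0) (at b within T)"
    by (rule *, unfold forall_4) (auto simp: coord_defs intro!: derivative_eq_intros)
  show "((\<lambda>s. coord_b (s, a, b)) has_vector_derivative coord_sb (s, a, b)) (at s within T)"
    by (rule *, unfold forall_4) (auto simp: coord_defs intro!: derivative_eq_intros)
  show "((\<lambda>a. coord_b (s, a, b)) has_vector_derivative 0) (at a within T)"
    by (rule *, unfold forall_4) (auto simp: coord_defs intro!: derivative_eq_intros)
qed

text \<open>
  The divergence theorem on a box when the fluxes through opposite faces cancel: integrate each term first in its
  own variable.
\<close>

lemma integral_divergence_box:
  fixes P Q R P' Q' R' :: "real \<times> real \<times> real \<Rightarrow> real" and l m n :: real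
  assumes pos: "0 \<le> l" "0 \<le> m" "0 \<le> n"
    and P': "\<And>s a b. ((\<lambda>s. P (s, a, b)) has_real_derivative P' (s, a, b)) (at s within {0..l})"
    and Q': "\<And>s a b. ((\<lambda>a. Q (s, a, b)) has_real_derivative Q' (s, a, b)) (at a within {0..m})"
    and R': "\<And>s a b. ((\<lambda>b. R (s, a, b)) has_real_derivative R' (s, a, b)) (at b within {0..n})"
    and cont: "continuous_on UNIV P'" "continuous_on UNIV Q'" "continuous_on UNIV R'"
    and bd: "\<And>a b. P (0, a, b) = P (l, a, b)" "\<And>s b. Q (s, 0, b) = Q (s, m, b)" "\<And>s a. R (s, a, 0) = R (s, a, n)"
  shows "integral (cbox (0, 0, 0) (l, m, n)) (\<lambda>q. P' q + Q' q + R' q) = 0"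
proof -
  have c: "continuous_on T (\<lambda>x. f (g x))" if "continuous_on UNIV f" "continuous_on T g"
    for f :: "real \<times> real \<times> real \<Rightarrow> real" and g :: "'c::topological_space \<Rightarrow> _" and T
    using continuous_on_compose2[OF that] by simp
  have int: "f integrable_on cbox (0, 0, 0) (l, m, n)" if "continuous_on UNIV f" for f :: "real \<times> real \<times> real \<Rightarrow> real"
    by (rule integrable_continuous) (rule continuous_on_subset[OF that], simp)
  have ftc: "integral (cbox 0 r) g = 0"
    if "0 \<le> r" "\<And>t. (f has_real_derivative g t) (at t within {0..r})" "f 0 = f r" for f g :: "real \<Rightarrow> real" and r
    using fundamental_theorem_of_calculus[OF that(1), of f g] that(2,3)
    by (simp add: has_real_derivative_iff_has_vector_derivative integral_unique)
  have "integral (cbox (0, 0, 0) (l, m, n)) P' =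
     integral (cbox 0 l) (\<lambda>s. integral (cbox (0, 0) (m, n)) (\<lambda>p. P' (s, p)))"
    by (rule integral_prod_continuous) (rule continuous_on_subset[OF cont(1)], simp)
  also have "\<dots> = integral (cbox (0, 0) (m, n)) (\<lambda>p. integral (cbox 0 l) (\<lambda>s. P' (s, p)))"
    by (rule integral_swap_continuous) (auto simp: case_prod_beta intro!: c[OF cont(1)] continuous_intros)
  also have "\<dots> = 0"
  proof -
    have "(\<lambda>p. integral (cbox 0 l) (\<lambda>s. P' (s, p))) = (\<lambda>p. 0)"
      using ftc[OF pos(1) P' bd(1)] by (simp add: fun_eq_iff split_paired_all)
    then show ?thesis by simp
  qed
  finally have 1: "integral (cbox (0, 0, 0) (l, m, n)) P' = 0" .
  have "integral (cbox (0, 0, 0) (l, m, n)) Q' =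
     integral (cbox 0 l) (\<lambda>s. integral (cbox (0, 0) (m, n)) (\<lambda>p. Q' (s, p)))"
    by (rule integral_prod_continuous) (rule continuous_on_subset[OF cont(2)], simp)
  also have "\<dots> = integral (cbox 0 l) (\<lambda>s. integral (cbox 0 m) (\<lambda>a. integral (cbox 0 n) (\<lambda>b. Q' (s, a, b))))"
    by (intro integral_cong integral_prod_continuous c[OF cont(2)] continuous_intros)
  also have "\<dots> = integral (cbox 0 l) (\<lambda>s. integral (cbox 0 n) (\<lambda>b. integral (cbox 0 m) (\<lambda>a. Q' (s, a, b))))"
    by (intro integral_cong integral_swap_continuous) (auto simp: case_prod_beta intro!: c[OF cont(2)] continuous_intros)
  also have "\<dots> = 0"
    using ftc[OF pos(2) Q' bd(2)] by simp
  finally have 2: "integral (cbox (0, 0, 0) (l, m, n)) Q' = 0" .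
  have "integral (cbox (0, 0, 0) (l, m, n)) R' =
     integral (cbox 0 l) (\<lambda>s. integral (cbox (0, 0) (m, n)) (\<lambda>p. R' (s, p)))"
    by (rule integral_prod_continuous) (rule continuous_on_subset[OF cont(3)], simp)
  also have "\<dots> = integral (cbox 0 l) (\<lambda>s. integral (cbox 0 m) (\<lambda>a. integral (cbox 0 n) (\<lambda>b. R' (s, a, b))))"
    by (intro integral_cong integral_prod_continuous c[OF cont(3)] continuous_intros)
  also have "\<dots> = 0"
    using ftc[OF pos(3) R' bd(3)] by simp
  finally have 3: "integral (cbox (0, 0, 0) (l, m, n)) R' = 0" .
  show ?thesis
    by (simp add: integral_add int cont continuous_on_add 1 2 3)
qed

text \<open>
  In the coordinates \<open>(s, a, b)\<close> the difference of the two integrands is the divergence of the field whose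
  components \<open>P\<close>, \<open>Q\<close>, \<open>R\<close> are the coefficients of \<open>\<alpha> \<and> \<beta>\<close>; the mixed second derivatives of the coordinate map cancel.
  The fluxes of \<open>Q\<close> and \<open>R\<close> cancel by periodicity. The component \<open>P\<close>, the value of \<open>\<alpha> \<and> \<beta>\<close> on the partial
  derivatives in \<open>a\<close> and \<open>b\<close>, vanishes on the faces \<open>s = 0\<close> and \<open>s = \<pi>/2\<close>, where one of these directions collapses.
\<close>

theorem stokes_S3:
  assumes "C1_form \<alpha>" "C1_form \<beta>"
  shows "S3_integral (wedge12 \<alpha> (ext_deriv \<beta>)) = S3_integral (wedge12 \<beta> (ext_deriv \<alpha>))"
proof -
  define F where "F = S3_coords"
  define As where "As \<gamma> q = radial_pullback \<gamma> (F q) (coord_s q)" for \<gamma> q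
  define Aa where "Aa \<gamma> q = radial_pullback \<gamma> (F q) (coord_a q)" for \<gamma> q
  define Ab where "Ab \<gamma> q = radial_pullback \<gamma> (F q) (coord_b q)" for \<gamma> q
  define D where "D \<gamma> q v w = frechet_derivative (\<lambda>y. radial_pullback \<gamma> y v) (at (F q)) w" for \<gamma> q v w
  define As_a where "As_a \<gamma> q = D \<gamma> q (coord_s q) (coord_a q) + radial_pullback \<gamma> (F q) (coord_sa q)" for \<gamma> q
  define As_b where "As_b \<gamma> q = D \<gamma> q (coord_s q) (coord_b q) + radial_pullback \<gamma> (F q) (coord_sb q)" for \<gamma> q
  define Aa_s where "Aa_s \<gamma> q = D \<gamma> q (coord_a q) (coord_s q) + radial_pullback \<gamma> (F q) (coord_sa q)" for \<gamma> q
  define Aa_b where "Aa_b \<gamma> q = D \<gamma> q (coord_a q) (coord_b q) + radial_pullback \<gamma> (F q) 0" for \<gamma> q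
  define Ab_s where "Ab_s \<gamma> q = D \<gamma> q (coord_b q) (coord_s q) + radial_pullback \<gamma> (F q) (coord_sb q)" for \<gamma> q
  define Ab_a where "Ab_a \<gamma> q = D \<gamma> q (coord_b q) (coord_a q) + radial_pullback \<gamma> (F q) 0" for \<gamma> q
  note defs = As_def Aa_def Ab_def As_a_def As_b_def Aa_s_def Aa_b_def Ab_s_def Ab_a_def
  have nz: "F q \<noteq> 0" for q using S3_nonzero[OF S3_coords_in_S3] by (simp add: F_def)
  have Fd: "((\<lambda>s. F (s, a, b)) has_vector_derivative coord_s (s, a, b)) (at s within T)"
    "((\<lambda>a. F (s, a, b)) has_vector_derivative coord_a (s, a, b)) (at a within T)"
    "((\<lambda>b. F (s, a, b)) has_vector_derivative coord_b (s, a, b)) (at b within T)" for s a b T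
    unfolding F_def by (rule coord_partial_derivs)+
  have d: "((\<lambda>a. As \<gamma> (s, a, b)) has_real_derivative As_a \<gamma> (s, a, b)) (at a within T)"
    "((\<lambda>b. As \<gamma> (s, a, b)) has_real_derivative As_b \<gamma> (s, a, b)) (at b within T)"
    "((\<lambda>s. Aa \<gamma> (s, a, b)) has_real_derivative Aa_s \<gamma> (s, a, b)) (at s within T)"
    "((\<lambda>b. Aa \<gamma> (s, a, b)) has_real_derivative Aa_b \<gamma> (s, a, b)) (at b within T)"
    "((\<lambda>s. Ab \<gamma> (s, a, b)) has_real_derivative Ab_s \<gamma> (s, a, b)) (at s within T)"
    "((\<lambda>a. Ab \<gamma> (s, a, b)) has_real_derivative Ab_a \<gamma> (s, a, b)) (at a within T)"
    if "C1_form \<gamma>" for \<gamma> s a b T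
    unfolding defs D_def
    by (rule radial_pullback_along_curve[OF that nz Fd(2) coord_partial_derivs(4)]
             radial_pullback_along_curve[OF that nz Fd(3) coord_partial_derivs(5)]
             radial_pullback_along_curve[OF that nz Fd(1) coord_partial_derivs(6)]
             radial_pullback_along_curve[OF that nz Fd(3) coord_partial_derivs(7)]
             radial_pullback_along_curve[OF that nz Fd(1) coord_partial_derivs(8)]
             radial_pullback_along_curve[OF that nz Fd(2) coord_partial_derivs(9)])+
  have cF: "continuous_on T F" for T unfolding F_def by (rule continuous_coords)
  have c: "continuous_on UNIV (As \<gamma>)" "continuous_on UNIV (Aa \<gamma>)" "continuous_on UNIV (Ab \<gamma>)"
    "continuous_on UNIV (As_a \<gamma>)" "continuous_on UNIV (As_b \<gamma>)" "continuous_on UNIV (Aa_s \<gamma>)"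
    "continuous_on UNIV (Aa_b \<gamma>)" "continuous_on UNIV (Ab_s \<gamma>)" "continuous_on UNIV (Ab_a \<gamma>)"
    if "C1_form \<gamma>" for \<gamma>
    unfolding defs[abs_def] D_def
    by (intro continuous_on_add continuous_on_radial_pullback[OF that] continuous_on_radial_pullback_deriv[OF that]
        cF continuous_coords continuous_on_const nz)+
  define P where "P q = Aa \<alpha> q * Ab \<beta> q - Ab \<alpha> q * Aa \<beta> q" for q
  define Q where "Q q = Ab \<alpha> q * As \<beta> q - As \<alpha> q * Ab \<beta> q" for q
  define R where "R q = As \<alpha> q * Aa \<beta> q - Aa \<alpha> q * As \<beta> q" for q
  define P' where "P' q = (Aa_s \<alpha> q * Ab \<beta> q + Ab_s \<beta> q * Aa \<alpha> q) - (Ab_s \<alpha> q * Aa \<beta> q + Aa_s \<beta> q * Ab \<alpha> q)" for q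
  define Q' where "Q' q = (Ab_a \<alpha> q * As \<beta> q + As_a \<beta> q * Ab \<alpha> q) - (As_a \<alpha> q * Ab \<beta> q + Ab_a \<beta> q * As \<alpha> q)" for q
  define R' where "R' q = (As_b \<alpha> q * Aa \<beta> q + Aa_b \<beta> q * As \<alpha> q) - (Aa_b \<alpha> q * As \<beta> q + As_b \<beta> q * Aa \<alpha> q)" for q
  note PQR = P_def Q_def R_def P'_def Q'_def R'_def
  note ab = assms
  have zero: "radial_pullback \<gamma> y 0 = 0" if "C1_form \<gamma>" "y \<noteq> 0" for \<gamma> y
    using linear_0[OF linear_radial_pullback[OF that]] .
  have "integral (cbox (0, 0, 0) (pi/2, 2*pi, 2*pi)) (\<lambda>q. P' q + Q' q + R' q) = 0"
  proof (rule integral_divergence_box[where P=P and Q=Q and R=R])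
    show "((\<lambda>s. P (s, a, b)) has_real_derivative P' (s, a, b)) (at s within {0..pi/2})" for s a b
      unfolding PQR by (intro DERIV_diff DERIV_mult d ab)
    show "((\<lambda>a. Q (s, a, b)) has_real_derivative Q' (s, a, b)) (at a within {0..2*pi})" for s a b
      unfolding PQR by (intro DERIV_diff DERIV_mult d ab)
    show "((\<lambda>b. R (s, a, b)) has_real_derivative R' (s, a, b)) (at b within {0..2*pi})" for s a b
      unfolding PQR by (intro DERIV_diff DERIV_mult d ab)
    show "continuous_on UNIV P'" "continuous_on UNIV Q'" "continuous_on UNIV R'"
      unfolding PQR[abs_def] by (intro continuous_intros c ab)+
    have "coord_a (0, a, b) = 0" "coord_b (pi/2, a, b) = 0" for a b
      by (simp_all add: coord_defs vec_eq_iff forall_4)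
    then show "P (0, a, b) = P (pi/2, a, b)" for a b
      by (simp add: PQR defs zero ab nz)
    show "Q (s, 0, b) = Q (s, 2*pi, b)" for s b
      by (simp add: PQR defs F_def coord_defs)
    show "R (s, a, 0) = R (s, a, 2*pi)" for s a
      by (simp add: PQR defs F_def coord_defs)
  qed simp_all
  moreover have "P' q + Q' q + R' q =
     wedge12 \<beta> (ext_deriv \<alpha>) (F q) (coord_s q) (coord_a q) (coord_b q)
     - wedge12 \<alpha> (ext_deriv \<beta>) (F q) (coord_s q) (coord_a q) (coord_b q)" for q
  proof -
    have "\<gamma> (F q) (coord_s q) = As \<gamma> q" "\<gamma> (F q) (coord_a q) = Aa \<gamma> q" "\<gamma> (F q) (coord_b q) = Ab \<gamma> q" for \<gamma>
      by (simp_all add: defs F_def radial_pullback_S3 S3_coords_in_S3 coord_tangent)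
    moreover have "ext_deriv \<gamma> (F q) (coord_s q) (coord_a q) = Aa_s \<gamma> q - As_a \<gamma> q"
      "ext_deriv \<gamma> (F q) (coord_a q) (coord_b q) = Ab_a \<gamma> q - Aa_b \<gamma> q"
      "ext_deriv \<gamma> (F q) (coord_b q) (coord_s q) = As_b \<gamma> q - Ab_s \<gamma> q" for \<gamma>
      by (simp_all add: defs ext_deriv_def D_def)
    ultimately show ?thesis
      by (simp only: wedge12_def PQR) (simp add: algebra_simps)
  qed
  moreover have "continuous_on UNIV (\<lambda>q. wedge12 \<gamma> (ext_deriv \<delta>) (F q) (coord_s q) (coord_a q) (coord_b q))"
    if "C1_form \<gamma>" "C1_form \<delta>" for \<gamma> \<delta>
  proof -
    have "wedge12 \<gamma> (ext_deriv \<delta>) (F q) (coord_s q) (coord_a q) (coord_b q) =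
      As \<gamma> q * (D \<delta> q (coord_b q) (coord_a q) - D \<delta> q (coord_a q) (coord_b q)) +
      Aa \<gamma> q * (D \<delta> q (coord_s q) (coord_b q) - D \<delta> q (coord_b q) (coord_s q)) +
      Ab \<gamma> q * (D \<delta> q (coord_a q) (coord_s q) - D \<delta> q (coord_s q) (coord_a q))" for q
      by (simp add: wedge12_def defs F_def radial_pullback_S3 S3_coords_in_S3 coord_tangent ext_deriv_def D_def)
    moreover have "continuous_on UNIV (\<lambda>q. As \<gamma> q * (D \<delta> q (coord_b q) (coord_a q) - D \<delta> q (coord_a q) (coord_b q)) +
      Aa \<gamma> q * (D \<delta> q (coord_s q) (coord_b q) - D \<delta> q (coord_b q) (coord_s q)) +
      Ab \<gamma> q * (D \<delta> q (coord_a q) (coord_s q) - D \<delta> q (coord_s q) (coord_a q)))"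
      unfolding D_def
      by (intro continuous_intros c that continuous_on_radial_pullback_deriv[OF that(2)] cF continuous_coords nz)
    ultimately show ?thesis by simp
  qed
  then have "(\<lambda>q. wedge12 \<gamma> (ext_deriv \<delta>) (F q) (coord_s q) (coord_a q) (coord_b q)) integrable_on
      cbox (0, 0, 0) (pi/2, 2*pi, 2*pi)" if "C1_form \<gamma>" "C1_form \<delta>" for \<gamma> \<delta>
    using that by (intro integrable_continuous) (auto intro: continuous_on_subset)
  ultimately show ?thesis
    using ab by (simp add: S3_integral_coords F_def[symmetric] integral_diff)
qed

declare vector_3 [simp]

section \<open>The Hopf map after the squaring map\<close>

definition hopf_deriv :: "real^4 \<Rightarrow> real^4 \<Rightarrow> real^3" where
  "hopf_deriv z u = vector
     [2 * (z$1 * u$3 + u$1 * z$3 + z$2 * u$4 + u$2 * z$4),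
      2 * (z$1 * u$4 + u$1 * z$4 - z$3 * u$2 - u$3 * z$2),
      2 * (z$1 * u$1 + z$2 * u$2 - z$3 * u$3 - z$4 * u$4)]"

definition psi_deriv :: "real^4 \<Rightarrow> real^4 \<Rightarrow> real^4" where
  "psi_deriv x v = vector
     [2 * (x$1 * v$1 - x$2 * v$2 - x$3 * v$3 - x$4 * v$4),
      2 * (x$1 * v$2 + v$1 * x$2),
      2 * (x$1 * v$3 + v$1 * x$3),
      2 * (x$1 * v$4 + v$1 * x$4)]"

lemma nth_has_derivative: "((\<lambda>x. x $ i) has_derivative (\<lambda>h. h $ i)) F"
  by (rule bounded_linear_imp_has_derivative[OF bounded_linear_vec_nth])

lemma hopf_map_has_derivative: "(hopf_map has_derivative hopf_deriv z) (at z)"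
proof -
  have "\<forall>i. ((\<lambda>x. hopf_map x $ i) has_derivative (\<lambda>h. hopf_deriv z h $ i)) (at z)"
    unfolding forall_3 hopf_map_def hopf_deriv_def
    by (intro conjI; simp; auto intro!: derivative_eq_intros nth_has_derivative simp: fun_eq_iff algebra_simps)
  then show ?thesis by (auto intro: has_derivative_vec)
qed

lemma psi_has_derivative: "(\<psi> has_derivative psi_deriv x) (at x)"
proof -
  have "\<forall>i. ((\<lambda>x. \<psi> x $ i) has_derivative (\<lambda>h. psi_deriv x h $ i)) (at x)"
    unfolding forall_4 \<psi>_def psi_deriv_def
    by (intro conjI; simp; auto intro!: derivative_eq_intros nth_has_derivative simp: fun_eq_iff algebra_simps)
  then show ?thesis by (auto intro: has_derivative_vec)
qed

text \<open>
  On \<open>S3\<close> a map may be replaced by any differentiable extension, in practice a polynomial one, before differentiating.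
\<close>

lemma differential_restrict:
  assumes x: "x \<in> S3" and P: "(P has_derivative P') (at x)" and f: "\<And>y. y \<in> S3 \<Longrightarrow> f y = P y"
  shows "differential f x v = P' (v - (x \<bullet> v) *\<^sub>R x)"
proof -
  have nz: "x \<noteq> 0" using S3_nonzero[OF x] .
  have "((\<lambda>y. P (sgn y)) has_derivative (\<lambda>v. P' (v - (x \<bullet> v) *\<^sub>R x))) (at x)"
    using has_derivative_compose[OF sgn_has_derivative[OF nz], of P P'] P x
    by (simp add: sgn_S3) (simp add: S3_def)
  then have "((\<lambda>y. f (sgn y)) has_derivative (\<lambda>v. P' (v - (x \<bullet> v) *\<^sub>R x))) (at x)"
    by (rule has_derivative_transform_within_open[where s="- {0}"]) (use nz f sgn_in_S3 in auto)
  then show ?thesis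
    unfolding differential_def by (rule frechet_derivative_at[symmetric, THEN fun_cong])
qed

lemma differential_restrict_tangent:
  assumes "x \<in> S3" "(P has_derivative P') (at x)" "\<And>y. y \<in> S3 \<Longrightarrow> f y = P y" "v \<in> tangent x"
  shows "differential f x v = P' v"
  using differential_restrict[OF assms(1-3), of v] assms(4) by (simp add: tangent_def inner_commute)

lemma inner4: "(x::real^4) \<bullet> y = x$1 * y$1 + x$2 * y$2 + x$3 * y$3 + x$4 * y$4"
  by (simp add: inner_vec_def sum_4)

lemma inner3: "(x::real^3) \<bullet> y = x$1 * y$1 + x$2 * y$2 + x$3 * y$3"
  by (simp add: inner_vec_def sum_3)

lemma psi_inner: "\<psi> x \<bullet> \<psi> x = (x \<bullet> x)\<^sup>2"
  by (simp add: inner4 \<psi>_def) algebra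

lemma psi_deriv_inner: "\<psi> x \<bullet> psi_deriv x v = 2 * (x \<bullet> x) * (x \<bullet> v)"
  by (simp add: inner4 \<psi>_def psi_deriv_def) algebra

lemma hopf_inner: "hopf_map z \<bullet> hopf_map z = (z \<bullet> z)\<^sup>2"
  by (simp add: inner4 inner3 hopf_map_def) algebra

lemma S3_iff_inner: "x \<in> S3 \<longleftrightarrow> x \<bullet> x = 1"
  by (simp add: S3_def norm_eq_1)

lemma S2_iff_inner: "x \<in> S2 \<longleftrightarrow> x \<bullet> x = 1"
  by (simp add: S2_def norm_eq_1)

lemma psi_S3: "x \<in> S3 \<Longrightarrow> \<psi> x \<in> S3"
  by (simp add: S3_iff_inner psi_inner)

lemma hopf_S3: "z \<in> S3 \<Longrightarrow> hopf_map z \<in> S2"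
  by (simp add: S3_iff_inner S2_iff_inner hopf_inner)

lemma psi_deriv_tangent: "v \<in> tangent x \<Longrightarrow> psi_deriv x v \<in> tangent (\<psi> x)"
  using psi_deriv_inner[of x v] by (simp add: tangent_def inner_commute)

text \<open>
  On tangent vectors of the unit sphere only the first term of the right side survives: the Hopf map pulls the area
  form back to \<open>1/2 d\<eta>\<close>. The other terms make the identity hold on all of \<open>real^4\<close>; they are those of the exterior
  derivative of \<open>\<eta> / (z \<bullet> z)\<close>.
\<close>

lemma area_form_hopf:
  "area_form (hopf_map z) (hopf_deriv z u) (hopf_deriv z w) =
    (z \<bullet> z)\<^sup>2 * (\<xi> u \<bullet> w) - (z \<bullet> z) * ((z \<bullet> u) * (\<xi> z \<bullet> w) - (z \<bullet> w) * (\<xi> z \<bullet> u))"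
  by (simp add: area_form_def inner4 inner3 cross3_def hopf_map_def hopf_deriv_def \<xi>_def) algebra

definition phi_deriv :: "real^4 \<Rightarrow> real^4 \<Rightarrow> real^3" where
  "phi_deriv x v = hopf_deriv (\<psi> x) (psi_deriv x v)"

abbreviation (input) hopf_psi where "hopf_psi \<equiv> hopf_map \<circ> \<psi>"

lemma phi_has_derivative: "(hopf_psi has_derivative phi_deriv x) (at x)"
  using diff_chain_at[OF psi_has_derivative hopf_map_has_derivative] by (simp add: phi_deriv_def[abs_def] o_def)

lemma differential_phi: "x \<in> S3 \<Longrightarrow> v \<in> tangent x \<Longrightarrow> differential hopf_psi x v = phi_deriv x v"
  by (rule differential_restrict_tangent[OF _ phi_has_derivative]) auto

lemma pullback_area_phi:
  assumes "x \<in> S3" "v \<in> tangent x" "w \<in> tangent x"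
  shows "pullback_area hopf_psi x v w = \<xi> (psi_deriv x v) \<bullet> psi_deriv x w"
  using psi_S3[OF assms(1)] psi_deriv_tangent[OF assms(2)] psi_deriv_tangent[OF assms(3)]
  by (simp add: pullback_area_def differential_phi[OF assms(1,2)] differential_phi[OF assms(1,3)]
      phi_deriv_def area_form_hopf S3_iff_inner tangent_def inner_commute)

section \<open>The steady Euler field\<close>

definition euler_field :: "real^4 \<Rightarrow> real^4" where
  "euler_field x = (4 * x$1) *\<^sub>R (x$1 *\<^sub>R \<xi> x - x$4 *\<^sub>R X1 x + x$3 *\<^sub>R X2 x)"

lemma pullback_area_phi_frame:
  assumes "x \<in> S3"
  shows "pullback_area hopf_psi x (X1 x) (X2 x) = 4 * x$1 * x$1"
    "pullback_area hopf_psi x (X2 x) (\<xi> x) = - 4 * x$1 * x$4"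
    "pullback_area hopf_psi x (\<xi> x) (X1 x) = 4 * x$1 * x$3"
proof -
  have n: "x$1*x$1 + x$2*x$2 + x$3*x$3 + x$4*x$4 = 1"
    using assms by (simp add: S3_iff_inner inner4)
  have "\<xi> (psi_deriv x (X1 x)) \<bullet> psi_deriv x (X2 x) = 4 * x$1 * x$1 * (x$1*x$1 + x$2*x$2 + x$3*x$3 + x$4*x$4)"
    "\<xi> (psi_deriv x (X2 x)) \<bullet> psi_deriv x (\<xi> x) = - 4 * x$1 * x$4 * (x$1*x$1 + x$2*x$2 + x$3*x$3 + x$4*x$4)"
    "\<xi> (psi_deriv x (\<xi> x)) \<bullet> psi_deriv x (X1 x) = 4 * x$1 * x$3 * (x$1*x$1 + x$2*x$2 + x$3*x$3 + x$4*x$4)"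
    by (simp add: inner4 psi_deriv_def \<xi>_def X1_def X2_def, algebra)+
  then show "pullback_area hopf_psi x (X1 x) (X2 x) = 4 * x$1 * x$1"
    "pullback_area hopf_psi x (X2 x) (\<xi> x) = - 4 * x$1 * x$4"
    "pullback_area hopf_psi x (\<xi> x) (X1 x) = 4 * x$1 * x$3"
    using assms by (simp_all add: n pullback_area_phi frame_tangent)
qed

lemma sharp_hodge_star:
  assumes "x \<in> S3"
  shows "sharp (hodge_star \<beta>) x = \<beta> x (X1 x) (X2 x) *\<^sub>R \<xi> x + \<beta> x (X2 x) (\<xi> x) *\<^sub>R X1 x + \<beta> x (\<xi> x) (X1 x) *\<^sub>R X2 x"
  using frame_orthonormal[OF assms] by (simp add: sharp_def hodge_star_def inner_commute)

lemma sharp_hodge_star_phi: "x \<in> S3 \<Longrightarrow> sharp (hodge_star (pullback_area hopf_psi)) x = euler_field x"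
  by (simp add: sharp_hodge_star pullback_area_phi_frame euler_field_def algebra_simps)

lemma euler_field_components:
  "euler_field x = vector
     [- 4 * (x$1)\<^sup>2 * x$2,
      4 * x$1 * ((x$1)\<^sup>2 - (x$3)\<^sup>2 - (x$4)\<^sup>2),
      4 * x$1 * (x$2 * x$3 - 2 * x$1 * x$4),
      4 * x$1 * (x$2 * x$4 + 2 * x$1 * x$3)]"
  by (simp add: euler_field_def \<xi>_def X1_def X2_def vec_eq_iff forall_4 power2_eq_square algebra_simps)

definition euler_deriv :: "real^4 \<Rightarrow> real^4 \<Rightarrow> real^4" where
  "euler_deriv x v = vector
     [- 8 * x$1 * x$2 * v$1 - 4 * (x$1)\<^sup>2 * v$2,
      4 * v$1 * ((x$1)\<^sup>2 - (x$3)\<^sup>2 - (x$4)\<^sup>2) + 8 * x$1 * (x$1 * v$1 - x$3 * v$3 - x$4 * v$4),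
      4 * v$1 * (x$2 * x$3 - 2 * x$1 * x$4) + 4 * x$1 * (v$2 * x$3 + x$2 * v$3 - 2 * v$1 * x$4 - 2 * x$1 * v$4),
      4 * v$1 * (x$2 * x$4 + 2 * x$1 * x$3) + 4 * x$1 * (v$2 * x$4 + x$2 * v$4 + 2 * v$1 * x$3 + 2 * x$1 * v$3)]"

lemma euler_field_has_derivative: "(euler_field has_derivative euler_deriv x) (at x)"
proof -
  have "\<forall>i. ((\<lambda>x. euler_field x $ i) has_derivative (\<lambda>h. euler_deriv x h $ i)) (at x)"
    unfolding forall_4 euler_field_components euler_deriv_def
    by (intro conjI; simp; auto intro!: derivative_eq_intros nth_has_derivative simp: fun_eq_iff algebra_simps power2_eq_square)
  then show ?thesis by (auto intro: has_derivative_vec)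
qed

lemma euler_field_inner: "x \<in> S3 \<Longrightarrow> euler_field x \<bullet> euler_field x = 16 * (x$1)\<^sup>2 * ((x$1)\<^sup>2 + (x$3)\<^sup>2 + (x$4)\<^sup>2)"
proof -
  assume "x \<in> S3"
  then have n: "x$1*x$1 + x$2*x$2 + x$3*x$3 + x$4*x$4 = 1"
    by (simp add: S3_iff_inner inner4)
  have "euler_field x \<bullet> euler_field x = 16 * (x$1)\<^sup>2 * ((x$1)\<^sup>2 + (x$3)\<^sup>2 + (x$4)\<^sup>2) * (x$1*x$1 + x$2*x$2 + x$3*x$3 + x$4*x$4)"
    by (simp add: euler_field_components inner4) algebra
  then show ?thesis by (simp add: n)
qed

text \<open>
  So the images of \<open>euler_field\<close> under the differential of \<open>\<psi>\<close> are tangent to the Hopf fibres.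
\<close>

lemma psi_deriv_euler: "psi_deriv x (euler_field x) = (8 * (x$1)\<^sup>2) *\<^sub>R \<xi> (\<psi> x)"
  by (simp add: euler_field_components psi_deriv_def \<xi>_def \<psi>_def vec_eq_iff forall_4; intro conjI; algebra)

lemma hopf_deriv_xi: "hopf_deriv z (\<xi> z) = 0"
  by (simp add: hopf_deriv_def \<xi>_def vec_eq_iff forall_3)

lemma smooth_S3I:
  assumes "\<And>k. Ck_on k (\<lambda>y. P (sgn y)) (- {0})" "\<And>x. x \<in> S3 \<Longrightarrow> f x = P x"
  shows "smooth_S3 f"
  unfolding smooth_S3_def Ck_S3_def
proof
  fix k
  show "Ck_on k (\<lambda>y. f (sgn y)) (- {0})"
    by (rule Ck_on_cong[OF assms(1)]) (auto simp: assms(2) sgn_in_S3)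
qed

lemma Ck_on_sgn_nth: "Ck_on k (\<lambda>y::real^4. sgn y $ i) (- {0})"
  by (intro Ck_on_vec_nth Ck_on_sgn open_punctured)

lemma smooth_phi: "smooth_S3 hopf_psi"
  by (rule smooth_S3I[of hopf_psi]) (simp_all add: hopf_map_def \<psi>_def, intro Ck_on_intros Ck_on_sgn_nth open_punctured)

lemma smooth_euler: 
  assumes "\<And>x. x \<in> S3 \<Longrightarrow> V x = euler_field x" shows "smooth_S3 V"
  by (rule smooth_S3I[OF _ assms]) (simp add: euler_field_components, intro Ck_on_intros Ck_on_sgn_nth open_punctured)

lemma smooth_pressure: "smooth_S3 (\<lambda>x::real^4. - 8 * (x$1)^4)"
  by (rule smooth_S3I[of "\<lambda>x::real^4. - 8 * (x$1)^4"]) (intro Ck_on_intros Ck_on_sgn_nth open_punctured, simp)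

lemma euler_tangent: "euler_field x \<in> tangent x"
  using frame_tangent[of x] by (simp add: tangent_def euler_field_def inner_add_left inner_diff_left)

lemma differential_pressure:
  assumes "x \<in> S3" "v \<in> tangent x"
  shows "differential (\<lambda>x. - 8 * (x$1)^4) x v = - 32 * (x$1)^3 * v$1"
proof -
  have "((\<lambda>x. - 8 * (x$1)^4) has_derivative (\<lambda>v. - 32 * (x$1)^3 * v$1)) (at x)" for x :: "real^4"
    by (auto intro!: derivative_eq_intros nth_has_derivative)
  from differential_restrict_tangent[OF assms(1) this _ assms(2)] show ?thesis by simp
qed

text \<open>
  The gradient of a function of \<open>x1\<close> alone points along the tangential part of the first coordinate vector.
\<close>

lemma grad_pressure:
  assumes "x \<in> S3"
  shows "grad (\<lambda>x. - 8 * (x$1)^4) x = (- 32 * (x$1)^3) *\<^sub>R (axis 1 1 - x$1 *\<^sub>R x)"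
proof -
  have "axis 1 1 - x$1 *\<^sub>R x \<in> tangent x"
    using assms by (simp add: tangent_def inner_diff_left S3_iff_inner inner_axis')
  note e = frame_expansion[OF assms this]
  have "(axis 1 1 - x$1 *\<^sub>R x) \<bullet> v = v$1" if "v \<in> tangent x" for v
    using that by (simp add: tangent_def inner_diff_left inner_diff_right inner_axis inner_commute)
  note e = e[unfolded this[OF frame_tangent(1)] this[OF frame_tangent(2)] this[OF frame_tangent(3)]]
  show ?thesis
    by (subst e) (simp only: grad_def sharp_def differential_pressure[OF assms] frame_tangent, simp add: algebra_simps)
qed

text \<open>
  The acceleration of the field in \<open>real^4\<close>. Its second term is normal to the sphere, so the covariant acceleration is
  the tangential part of the first one, which is minus the gradient of the pressure.
\<close>

lemma euler_deriv_euler: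
  assumes "x \<in> S3"
  shows "euler_deriv x (euler_field x) =
    (32 * (x$1)^3) *\<^sub>R axis 1 1 - (16 * (x$1)\<^sup>2 * (1 + 2 * (x$1)\<^sup>2 - (x$2)\<^sup>2)) *\<^sub>R x"
proof -
  define r where "r = (x$1)\<^sup>2 + (x$2)\<^sup>2 + (x$3)\<^sup>2 + (x$4)\<^sup>2"
  have "euler_deriv x (euler_field x) =
    (32 * (x$1)^3 * r) *\<^sub>R axis 1 1 - (16 * (x$1)\<^sup>2 * (r + 2 * (x$1)\<^sup>2 - (x$2)\<^sup>2)) *\<^sub>R x"
    by (simp add: vec_eq_iff forall_4 euler_deriv_def euler_field_components axis_def r_def;
        intro conjI; algebra)
  then show ?thesis using S3_components[OF assms] by (simp add: r_def)
qed

lemma divergence_euler_trace: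
  "euler_deriv x (\<xi> x) \<bullet> \<xi> x + euler_deriv x (X1 x) \<bullet> X1 x + euler_deriv x (X2 x) \<bullet> X2 x = 0"
  by (simp add: inner4 euler_deriv_def \<xi>_def X1_def X2_def) algebra

lemma cov_deriv_euler:
  assumes "x \<in> S3" "\<And>x. x \<in> S3 \<Longrightarrow> V x = euler_field x" "v \<in> tangent x"
  shows "cov_deriv V x v = euler_deriv x v - (euler_deriv x v \<bullet> x) *\<^sub>R x"
  by (simp add: cov_deriv_def differential_restrict_tangent[OF assms(1) euler_field_has_derivative assms(2,3)])

lemma steady_euler_euler_field:
  assumes V: "\<And>x. x \<in> S3 \<Longrightarrow> V x = euler_field x"
  shows "steady_euler_with_pressure V (\<lambda>x. - 8 * (x$1)^4)"
  unfolding steady_euler_with_pressure_def smooth_vector_field_def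
proof (intro conjI ballI)
  show "smooth_S3 V" by (rule smooth_euler[OF V])
  show "smooth_S3 (\<lambda>x::real^4. - 8 * (x$1)^4)" by (rule smooth_pressure)
  fix x assume x: "x \<in> S3"
  show "V x \<in> tangent x" by (simp add: V x euler_tangent)
  have cd: "cov_deriv V x v = euler_deriv x v - (euler_deriv x v \<bullet> x) *\<^sub>R x" if "v \<in> tangent x" for v
    by (rule cov_deriv_euler[OF x V that])
  have xx: "x \<bullet> x = 1" using x by (simp add: S3_iff_inner)
  show "cov_deriv V x (V x) = - grad (\<lambda>x. - 8 * (x$1)^4) x"
    unfolding V[OF x] cd[OF euler_tangent] grad_pressure[OF x] euler_deriv_euler[OF x]
    by (simp add: inner_diff_left inner_axis' xx algebra_simps power_numeral_reduce)
  have "(u - (u \<bullet> x) *\<^sub>R x) \<bullet> e = u \<bullet> e" if "e \<in> tangent x" for u e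
    using that by (simp add: tangent_def inner_diff_left inner_commute[of x])
  then show "divergence V x = 0"
    using divergence_euler_trace[of x]
    by (simp add: divergence_def cd frame_tangent)
qed

section \<open>Integrability and rank\<close>

lemma phi_deriv_orthogonal:
  assumes "v \<in> tangent x"
  shows "hopf_map (\<psi> x) \<bullet> phi_deriv x v = 0"
proof -
  have "hopf_map z \<bullet> hopf_deriv z u = 2 * (z \<bullet> z) * (z \<bullet> u)" for z u
    by (simp add: inner4 inner3 hopf_map_def hopf_deriv_def) algebra
  then show ?thesis
    using psi_deriv_tangent[OF assms] by (simp add: phi_deriv_def tangent_def inner_commute)
qed

lemma linear_phi_deriv: "linear (phi_deriv x)"
  by (rule has_derivative_linear[OF phi_has_derivative])

lemma rank_phi_le:
  assumes x: "x \<in> S3"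
  shows "rank_at hopf_psi x \<le> 2"
proof -
  have nz: "hopf_psi x \<noteq> 0"
    using hopf_S3[OF psi_S3[OF x]] by (auto simp: S2_def)
  have "differential hopf_psi x ` tangent x \<subseteq> {y. hopf_psi x \<bullet> y = 0}"
    using x by (auto simp: differential_phi phi_deriv_orthogonal)
  then have "dim (differential hopf_psi x ` tangent x) \<le> dim {y. hopf_psi x \<bullet> y = 0}"
    by (rule dim_subset)
  also have "\<dots> = 2"
    using dim_hyperplane[OF nz] by simp
  finally show ?thesis by (simp add: rank_at_def)
qed

text \<open>
  Where the pullback of the area form is nonzero, the images of two frame vectors have a nonzero cross product.
\<close>

lemma rank_phi_ge:
  assumes x: "x \<in> S3" and a: "x$1 \<noteq> 0"
  shows "rank_at hopf_psi x \<ge> 2"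
proof -
  let ?D = "differential hopf_psi x"
  have nz: "pullback_area hopf_psi x (X1 x) (X2 x) \<noteq> 0"
    using a by (simp add: pullback_area_phi_frame x)
  have cr: "cross3 (?D (X1 x)) (?D (X2 x)) \<noteq> 0"
    using nz by (auto simp: pullback_area_def area_form_def)
  then have "\<not> (?D (X1 x) = 0 \<or> ?D (X2 x) = 0 \<or> (\<exists>c. ?D (X2 x) = c *\<^sub>R ?D (X1 x)))"
    by (simp add: cross_eq_0 collinear_lemma)
  then have ind: "independent {?D (X2 x), ?D (X1 x)}" and ne: "?D (X2 x) \<noteq> ?D (X1 x)"
    by (auto simp: independent_insert span_singleton) (metis scaleR_one)
  have "card {?D (X2 x), ?D (X1 x)} \<le> dim (?D ` tangent x)"
    by (rule independent_card_le_dim[OF _ ind]) (auto intro: frame_tangent)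
  then show ?thesis using ne by (simp add: rank_at_def)
qed

lemma differential_phi_euler: "x \<in> S3 \<Longrightarrow> differential hopf_psi x (euler_field x) = 0"
  by (simp add: differential_phi euler_tangent phi_deriv_def psi_deriv_euler
      linear_scale[OF has_derivative_linear[OF hopf_map_has_derivative]] hopf_deriv_xi)

lemma S2_integrable_euler:
  assumes V: "\<And>x. x \<in> S3 \<Longrightarrow> V x = euler_field x"
  shows "S2_integrable V"
  unfolding S2_integrable_def
proof (intro conjI exI[of _ hopf_psi] ballI impI)
  show "smooth_vector_field V"
    using steady_euler_euler_field[OF V] by (simp add: steady_euler_with_pressure_def)
  show "Ck_S3 2 hopf_psi" using smooth_phi by (simp add: smooth_S3_def)
  show "hopf_psi ` S3 \<subseteq> S2" using hopf_S3 psi_S3 by auto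
  fix x assume x: "x \<in> S3"
  show "differential hopf_psi x (V x) = 0" by (simp only: V[OF x] differential_phi_euler[OF x])
  assume "rank_at hopf_psi x < 2"
  then have "x$1 = 0" using rank_phi_ge[OF x] by fastforce
  then show "V x = 0" by (simp add: V x euler_field_def)
qed

text \<open>
  A point of the great sphere \<open>x1 = 0\<close> is the limit of the projections to \<open>S3\<close> of its translates in the direction \<open>x1\<close>.
\<close>

lemma almost_submersion_phi: "almost_submersion hopf_psi"
  unfolding almost_submersion_def
proof
  fix x assume x: "x \<in> S3"
  have rk: "y \<in> {x \<in> S3. rank_at hopf_psi x = 2}" if "y \<in> S3" "y$1 \<noteq> 0" for y
    using rank_phi_le[OF that(1)] rank_phi_ge[OF that] that by simp
  show "x \<in> closure {x \<in> S3. rank_at hopf_psi x = 2}"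
  proof (cases "x$1 = 0")
    case False
    then show ?thesis by (intro subsetD[OF closure_subset] rk x)
  next
    case True
    define y where "y n = sgn (x + inverse (real (Suc n)) *\<^sub>R axis 1 1)" for n
    have 1: "(x + inverse (real (Suc n)) *\<^sub>R axis 1 1) $ 1 \<noteq> 0" for n
      using True by (simp add: axis_def del: of_nat_Suc)
    have nz: "x + inverse (real (Suc n)) *\<^sub>R axis 1 1 \<noteq> 0" for n
      by (metis 1 zero_index)
    have "y n \<in> {x \<in> S3. rank_at hopf_psi x = 2}" for n
    proof (rule rk)
      show "y n \<in> S3" unfolding y_def by (rule sgn_in_S3[OF nz])
      show "y n $ 1 \<noteq> 0"
        using nz[of n] 1[of n] by (simp add: y_def sgn_div_norm del: of_nat_Suc)
    qed
    moreover have "y \<longlonglongrightarrow> sgn (x + 0 *\<^sub>R axis 1 1)"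
      unfolding y_def
      by (intro tendsto_intros LIMSEQ_inverse_real_of_nat) (use S3_nonzero[OF x] in auto)
    then have "y \<longlonglongrightarrow> x" by (simp add: sgn_S3[OF x])
    ultimately show ?thesis unfolding closure_sequential by blast
  qed
qed

section \<open>The 1-form dual to a vector field\<close>

lemma Ck_on_inner_field:
  assumes "smooth_S3 P"
  shows "Ck_on k (\<lambda>y. radial_pullback (\<lambda>x v. P x \<bullet> v) y v) (- {0})"
proof -
  have "Ck_on k (\<lambda>y. P (sgn y) \<bullet> (inverse (norm y) *\<^sub>R (v - (sgn y \<bullet> v) *\<^sub>R sgn y))) (- {0})"
    using assms
    by (intro Ck_on_intros Ck_on_scaleR Ck_on_sgn Ck_on_inverse_norm open_punctured)
      (simp_all add: smooth_S3_def Ck_S3_def)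
  then show ?thesis
    by (rule Ck_on_cong) (auto simp: radial_pullback_def frechet_derivative_sgn divide_inverse)
qed

lemma smooth_form1_inner_field:
  assumes "smooth_S3 P"
  shows "smooth_form1 (\<lambda>x v. P x \<bullet> v)"
  unfolding smooth_form1_def smooth_on_def
proof (intro conjI ballI allI)
  show "\<exists>L. linear L \<and> (\<forall>v\<in>tangent x. P x \<bullet> v = L v)" for x
    by (rule exI[of _ "\<lambda>v. P x \<bullet> v"]) (simp add: linear_iff inner_add_right)
qed (rule Ck_on_inner_field[OF assms])

text \<open>
  The pullback along the retraction projects \<open>P\<close> to its tangential part. The radial part of \<open>P\<close> enters the derivative
  only through the term \<open>(v \<bullet> w) * (P x \<bullet> x)\<close>, which is symmetric in \<open>v\<close> and \<open>w\<close> and cancels.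
\<close>

lemma ext_deriv_inner_field:
  assumes P: "(P has_derivative P') (at x)" and x: "x \<in> S3" "v \<in> tangent x" "w \<in> tangent x"
  shows "ext_deriv (\<lambda>x v. P x \<bullet> v) x v w = P' v \<bullet> w - P' w \<bullet> v"
proof -
  have nz: "x \<noteq> 0" using S3_nonzero x by auto
  have D: "frechet_derivative (\<lambda>y. radial_pullback (\<lambda>x v. P x \<bullet> v) y w) (at x) v =
      P' v \<bullet> w - (v \<bullet> w) * (P x \<bullet> x)" if vw: "v \<in> tangent x" "w \<in> tangent x" for v w
  proof -
    have s: "(sgn has_derivative (\<lambda>v. v - (x \<bullet> v) *\<^sub>R x)) (at x)"
      using sgn_has_derivative[OF nz] x(1) by (simp add: sgn_S3) (simp add: S3_def)
    have Ps: "((\<lambda>y. P (sgn y)) has_derivative (\<lambda>v. P' (v - (x \<bullet> v) *\<^sub>R x))) (at x)"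
      using has_derivative_compose[OF s, of P P'] P x by (simp add: sgn_S3)
    have n: "((\<lambda>y. inverse (norm y)) has_derivative (\<lambda>v. - (v \<bullet> x))) (at x)"
      using Deriv.has_derivative_inverse[OF _ has_derivative_norm[OF nz]] nz x(1)
      by (simp add: sgn_S3) (simp add: S3_def)
    have "((\<lambda>y. P (sgn y) \<bullet> (inverse (norm y) *\<^sub>R (w - (sgn y \<bullet> w) *\<^sub>R sgn y))) has_derivative
        (\<lambda>v. P x \<bullet> (inverse (norm x) *\<^sub>R (0 - ((x \<bullet> w) *\<^sub>R (v - (x \<bullet> v) *\<^sub>R x) + ((v - (x \<bullet> v) *\<^sub>R x) \<bullet> w) *\<^sub>R x))
            + (- (v \<bullet> x)) *\<^sub>R (w - (x \<bullet> w) *\<^sub>R x)) + P' (v - (x \<bullet> v) *\<^sub>R x) \<bullet> (inverse (norm x) *\<^sub>R (w - (x \<bullet> w) *\<^sub>R x)))) (at x)"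
      using has_derivative_inner[OF Ps has_derivative_scaleR[OF n has_derivative_diff[OF has_derivative_const[of w]
          has_derivative_scaleR[OF has_derivative_inner_left[OF s] s]]]] x
      by (simp add: sgn_S3)
    then have "((\<lambda>y. radial_pullback (\<lambda>x v. P x \<bullet> v) y w) has_derivative
        (\<lambda>v. P x \<bullet> (inverse (norm x) *\<^sub>R (0 - ((x \<bullet> w) *\<^sub>R (v - (x \<bullet> v) *\<^sub>R x) + ((v - (x \<bullet> v) *\<^sub>R x) \<bullet> w) *\<^sub>R x))
            + (- (v \<bullet> x)) *\<^sub>R (w - (x \<bullet> w) *\<^sub>R x)) + P' (v - (x \<bullet> v) *\<^sub>R x) \<bullet> (inverse (norm x) *\<^sub>R (w - (x \<bullet> w) *\<^sub>R x)))) (at x)"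
      by (rule has_derivative_transform_within_open[where s="- {0}"])
         (use nz in \<open>auto simp: radial_pullback_def frechet_derivative_sgn divide_inverse\<close>)
    note D = fun_cong[OF frechet_derivative_at[OF this, symmetric], of v]
    have "x \<bullet> v = 0" "v \<bullet> x = 0" "x \<bullet> w = 0" "norm x = 1"
      using vw x(1) by (auto simp: tangent_def S3_def inner_commute[of x])
    then show ?thesis by (simp add: D)
  qed
  show ?thesis
    by (simp add: ext_deriv_def D x inner_commute[of w v])
qed

section \<open>The Hopf invariant\<close>

text \<open>
  The vector field dual to the 1-form \<open>1/2 \<psi>\<^sup>*\<eta>\<close>, computed in \<open>real^4\<close>. Since \<open>d\<close> commutes with pullbacks and the
  area form pulls back to \<open>1/2 d\<eta>\<close> under the Hopf map, it is dual to a primitive of the pullback of the area form.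
\<close>

definition hopf_primitive :: "real^4 \<Rightarrow> real^4" where
  "hopf_primitive x = (let N = (x$1)\<^sup>2 - (x$2)\<^sup>2 - (x$3)\<^sup>2 - (x$4)\<^sup>2 in vector
     [x$2 * N - 2 * (x$1)\<^sup>2 * x$2,
      x$1 * N + 2 * x$1 * (x$2)\<^sup>2,
      2 * x$1 * x$2 * x$3 - 2 * (x$1)\<^sup>2 * x$4,
      2 * x$1 * x$2 * x$4 + 2 * (x$1)\<^sup>2 * x$3])"

definition hopf_primitive_deriv :: "real^4 \<Rightarrow> real^4 \<Rightarrow> real^4" where
  "hopf_primitive_deriv x v = (let N = (x$1)\<^sup>2 - (x$2)\<^sup>2 - (x$3)\<^sup>2 - (x$4)\<^sup>2;
       N' = 2 * (x$1 * v$1 - x$2 * v$2 - x$3 * v$3 - x$4 * v$4) in vector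
     [v$2 * N + x$2 * N' - 4 * x$1 * v$1 * x$2 - 2 * (x$1)\<^sup>2 * v$2,
      v$1 * N + x$1 * N' + 2 * v$1 * (x$2)\<^sup>2 + 4 * x$1 * x$2 * v$2,
      2 * v$1 * x$2 * x$3 + 2 * x$1 * v$2 * x$3 + 2 * x$1 * x$2 * v$3 - 4 * x$1 * v$1 * x$4 - 2 * (x$1)\<^sup>2 * v$4,
      2 * v$1 * x$2 * x$4 + 2 * x$1 * v$2 * x$4 + 2 * x$1 * x$2 * v$4 + 4 * x$1 * v$1 * x$3 + 2 * (x$1)\<^sup>2 * v$3])"

lemma hopf_primitive_has_derivative: "(hopf_primitive has_derivative hopf_primitive_deriv x) (at x)"
proof -
  have "\<forall>i. ((\<lambda>x. hopf_primitive x $ i) has_derivative (\<lambda>h. hopf_primitive_deriv x h $ i)) (at x)"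
    unfolding forall_4 hopf_primitive_def hopf_primitive_deriv_def Let_def
    by (intro conjI; simp; auto intro!: derivative_eq_intros nth_has_derivative simp: fun_eq_iff algebra_simps power2_eq_square)
  then show ?thesis by (auto intro: has_derivative_vec)
qed

lemma hopf_primitive_curl:
  "hopf_primitive_deriv x v \<bullet> w - hopf_primitive_deriv x w \<bullet> v = \<xi> (psi_deriv x v) \<bullet> psi_deriv x w"
  by (simp add: inner4 hopf_primitive_deriv_def Let_def psi_deriv_def \<xi>_def) algebra

lemma smooth_hopf_primitive: "smooth_S3 hopf_primitive"
  by (rule smooth_S3I[of hopf_primitive]) (simp_all add: hopf_primitive_def Let_def, intro Ck_on_intros Ck_on_sgn_nth open_punctured)

lemma hopf_primitive_euler:
  assumes "x \<in> S3" shows "hopf_primitive x \<bullet> euler_field x = 4 * (x$1)\<^sup>2"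
proof -
  have "hopf_primitive x \<bullet> euler_field x = 4 * (x$1)\<^sup>2 * ((x$1)\<^sup>2 + (x$2)\<^sup>2 + (x$3)\<^sup>2 + (x$4)\<^sup>2)\<^sup>2"
    by (simp add: inner4 hopf_primitive_def Let_def euler_field_components) algebra
  then show ?thesis by (simp add: S3_components[OF assms])
qed

lemma area_primitive_hopf: "area_primitive hopf_psi (\<lambda>x v. hopf_primitive x \<bullet> v)"
  unfolding area_primitive_def
  by (auto simp: smooth_form1_inner_field smooth_hopf_primitive pullback_area_phi
      ext_deriv_inner_field[OF hopf_primitive_has_derivative] hopf_primitive_curl simp del: o_apply)

lemma S2_total_area: "S2_total_area = pi"
proof -
  have "S2_total_area = integral (cbox (0, 0) (pi, 2*pi)) (\<lambda>q. 1/4 * sin (fst q))"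
    unfolding S2_total_area_def by (rule integral_cong) (auto simp: area_form_chart[simplified])
  also have "\<dots> = integral (cbox 0 pi) (\<lambda>u. integral (cbox 0 (2*pi)) (\<lambda>v. 1/4 * sin u))"
    by (subst integral_prod_continuous) (auto intro!: continuous_intros)
  also have "\<dots> = integral {0..pi} (\<lambda>u. pi/2 * sin u)"
    by simp
  also have "\<dots> = pi"
  proof (rule integral_unique)
    have "((\<lambda>u. pi/2 * sin u) has_integral (- pi/2 * cos pi - (- pi/2 * cos 0))) {0..pi}"
      by (rule fundamental_theorem_of_calculus)
         (auto intro!: derivative_eq_intros simp flip: has_real_derivative_iff_has_vector_derivative)
    then show "((\<lambda>u. pi/2 * sin u) has_integral pi) {0..pi}" by simp
  qed
  finally show ?thesis .
qed

text \<open>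
  The function \<open>8 x1\<^sup>2\<close> is the Jacobian of squaring, which has degree 2; so the integral of half of it is the volume
  \<open>2 \<pi>\<^sup>2\<close> of \<open>S3\<close>.
\<close>

lemma integral_degree:
  "integral (cbox (0, 0, 0) (pi/2, 2*pi, 2*pi)) (\<lambda>q. 4 * (S3_coords q $ 1)\<^sup>2 * (sin (fst q) * cos (fst q))) = 2 * pi\<^sup>2"
proof -
  have i1: "integral {0..2*pi} (\<lambda>a. (cos a)\<^sup>2) = pi"
  proof (rule integral_unique)
    have "((\<lambda>a. (cos a)\<^sup>2) has_integral ((2*pi + sin (2*pi) * cos (2*pi))/2 - (0 + sin 0 * cos 0)/2)) {0..2*pi}"
      by (rule fundamental_theorem_of_calculus)
         (auto intro!: derivative_eq_intros simp: sin_squared_eq power2_eq_square[symmetric] simp flip: has_real_derivative_iff_has_vector_derivative)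
    then show "((\<lambda>a. (cos a)\<^sup>2) has_integral pi) {0..2*pi}" by simp
  qed
  have i2: "integral {0..pi/2} (\<lambda>s. (sin s)^3 * cos s) = 1/4"
  proof (rule integral_unique)
    have "((\<lambda>s. (sin s)^3 * cos s) has_integral ((sin (pi/2))^4/4 - (sin 0)^4/4)) {0..pi/2}"
      by (rule fundamental_theorem_of_calculus)
         (auto intro!: derivative_eq_intros simp flip: has_real_derivative_iff_has_vector_derivative)
    then show "((\<lambda>s. (sin s)^3 * cos s) has_integral (1/4)) {0..pi/2}" by simp
  qed
  have "integral (cbox (0, 0, 0) (pi/2, 2*pi, 2*pi)) (\<lambda>q. 4 * (S3_coords q $ 1)\<^sup>2 * (sin (fst q) * cos (fst q))) =
     integral (cbox (0, 0, 0) (pi/2, 2*pi, 2*pi)) (\<lambda>q. 4 * ((sin (fst q))^3 * cos (fst q)) * (cos (fst (snd q)))\<^sup>2)"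
    by (rule integral_cong) (auto simp: S3_coords_def power_mult_distrib power_numeral_reduce)
  also have "\<dots> = integral (cbox 0 (pi/2)) (\<lambda>s. integral (cbox (0, 0) (2*pi, 2*pi)) (\<lambda>p. 4 * ((sin s)^3 * cos s) * (cos (fst p))\<^sup>2))"
    by (subst integral_prod_continuous) (auto intro!: continuous_intros)
  also have "\<dots> = integral (cbox 0 (pi/2)) (\<lambda>s. 8 * pi\<^sup>2 * ((sin s)^3 * cos s))"
  proof (rule integral_cong)
    fix s :: real
    have "integral (cbox (0, 0) (2*pi, 2*pi)) (\<lambda>p. 4 * ((sin s)^3 * cos s) * (cos (fst p))\<^sup>2) =
       integral (cbox 0 (2*pi)) (\<lambda>a. integral (cbox 0 (2*pi)) (\<lambda>b. 4 * ((sin s)^3 * cos s) * (cos a)\<^sup>2))"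
      by (subst integral_prod_continuous) (auto intro!: continuous_intros)
    also have "\<dots> = integral {0..2*pi} (\<lambda>a. (8 * pi * ((sin s)^3 * cos s)) * (cos a)\<^sup>2)"
      by (simp add: mult_ac)
    also have "\<dots> = 8 * pi\<^sup>2 * ((sin s)^3 * cos s)"
      by (simp only: integral_mult_right i1) (simp add: power2_eq_square)
    finally show "integral (cbox (0, 0) (2*pi, 2*pi)) (\<lambda>p. 4 * ((sin s)^3 * cos s) * (cos (fst p))\<^sup>2) = 8 * pi\<^sup>2 * ((sin s)^3 * cos s)" .
  qed
  also have "\<dots> = 2 * pi\<^sup>2"
    by (simp add: integral_mult_right i2)
  finally show ?thesis .
qed

lemma S3_integral_cong:
  assumes "\<And>x u v w. x \<in> S3 \<Longrightarrow> u \<in> tangent x \<Longrightarrow> v \<in> tangent x \<Longrightarrow> w \<in> tangent x \<Longrightarrow> \<Theta> x u v w = \<Theta>' x u v w"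
  shows "S3_integral \<Theta> = S3_integral \<Theta>'"
  unfolding S3_integral_coords by (simp add: assms S3_coords_in_S3 coord_tangent)

text \<open>
  By Stokes' theorem \<open>\<alpha> \<and> d\<alpha>0\<close> and \<open>\<alpha>0 \<and> d\<alpha>\<close> have the same integral. As \<open>d\<alpha> = d\<alpha>0\<close>, this exchanges an arbitrary
  primitive \<open>\<alpha>\<close> for the explicit one.
\<close>

lemma hopf_invariant_phi: "has_hopf_invariant hopf_psi 2"
  unfolding has_hopf_invariant_def
proof (intro conjI allI impI)
  define \<alpha>0 where "\<alpha>0 = (\<lambda>x v. hopf_primitive x \<bullet> v)"
  have a0: "area_primitive hopf_psi \<alpha>0" unfolding \<alpha>0_def by (rule area_primitive_hopf)
  then show "\<exists>\<alpha>. area_primitive hopf_psi \<alpha>" by blast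
  have C0: "C1_form \<alpha>0" using a0 by (simp add: area_primitive_def smooth_form1_imp_C1)
  fix \<alpha> assume a: "area_primitive hopf_psi \<alpha>"
  then have C: "C1_form \<alpha>" by (simp add: area_primitive_def smooth_form1_imp_C1)
  have eq: "ext_deriv \<beta> x v w = pullback_area hopf_psi x v w"
    if "area_primitive hopf_psi \<beta>" "x \<in> S3" "v \<in> tangent x" "w \<in> tangent x" for \<beta> x v w
    using that by (auto simp: area_primitive_def)
  have "S3_integral (wedge12 \<alpha> (pullback_area hopf_psi)) = S3_integral (wedge12 \<alpha> (ext_deriv \<alpha>0))"
    by (rule S3_integral_cong) (simp add: wedge12_def eq[OF a0])
  also have "\<dots> = S3_integral (wedge12 \<alpha>0 (ext_deriv \<alpha>))"
    by (rule stokes_S3[OF C C0])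
  also have "\<dots> = S3_integral (wedge12 \<alpha>0 (ext_deriv \<alpha>0))"
    by (rule S3_integral_cong) (simp add: wedge12_def eq[OF a] eq[OF a0])
  also have "\<dots> = integral (cbox (0, 0, 0) (pi/2, 2*pi, 2*pi)) (\<lambda>q. 4 * (S3_coords q $ 1)\<^sup>2 * (sin (fst q) * cos (fst q)))"
  proof (rule S3_integral_vol)
    fix x u v w assume x: "x \<in> S3" "u \<in> tangent x" "v \<in> tangent x" "w \<in> tangent x"
    have "wedge12 \<alpha>0 (ext_deriv \<alpha>0) x (\<xi> x) (X1 x) (X2 x) = hopf_primitive x \<bullet> euler_field x"
      by (simp add: wedge12_def eq[OF a0 x(1)] frame_tangent pullback_area_phi_frame[OF x(1)])
        (simp add: \<alpha>0_def euler_field_def inner_add_right inner_diff_right algebra_simps)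
    then show "wedge12 \<alpha>0 (ext_deriv \<alpha>0) x u v w = 4 * (x$1)\<^sup>2 * vol_form x u v w"
      using wedge12_ext_deriv_vol[OF C0 C0 x] by (simp add: hopf_primitive_euler x)
  qed
  also have "\<dots> = 2 * pi\<^sup>2" by (rule integral_degree)
  finally show "2 = 1 / S2_total_area\<^sup>2 * S3_integral (wedge12 \<alpha> (pullback_area hopf_psi))"
    by (simp add: S2_total_area)
qed

section \<open>The area form and the curl of the Euler field\<close>

lemma bounded_bilinear_cross3: "bounded_bilinear cross3"
  using bilinear_cross by (simp add: bilinear_conv_bounded_bilinear)

lemma area_form_has_derivative:
  assumes "(a has_derivative a') (at x within T)" "(b has_derivative b') (at x within T)" "(c has_derivative c') (at x within T)"
  shows "((\<lambda>y. area_form (a y) (b y) (c y)) has_derivative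
    (\<lambda>h. area_form (a' h) (b x) (c x) + area_form (a x) (b' h) (c x) + area_form (a x) (b x) (c' h))) (at x within T)"
proof -
  note 1 = bounded_bilinear.FDERIV[OF bounded_bilinear_cross3 assms(2,3)]
  note 2 = has_derivative_mult_right[OF has_derivative_inner[OF assms(1) 1], of "1/4"]
  show ?thesis
    unfolding area_form_def
    by (rule has_derivative_eq_rhs[OF 2]) (simp add: fun_eq_iff inner_add_right algebra_simps)
qed

lemma Ck_on_area_form:
  assumes "Ck_on k a S" "Ck_on k b S" "Ck_on k c S" "open S"
  shows "Ck_on k (\<lambda>y. area_form (a y) (b y) (c y)) S"
  unfolding area_form_def
  by (intro Ck_on_mult Ck_on_const Ck_on_inner Ck_on_bilinear[OF bounded_bilinear_cross3] assms)

lemma continuous_on_area_form: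
  assumes "continuous_on T a" "continuous_on T b" "continuous_on T c"
  shows "continuous_on T (\<lambda>y. area_form (a y) (b y) (c y))"
  unfolding area_form_def
  by (intro continuous_intros bounded_bilinear.continuous_on[OF bounded_bilinear_cross3] assms)

lemma area_form_skew: "area_form a b c = - area_form a c b"
  by (simp add: area_form_def inner3 cross3_def algebra_simps)

text \<open>
  Three vectors in a plane are linearly dependent.
\<close>

lemma area_form_orthogonal_zero:
  assumes "n \<bullet> n = 1" "n \<bullet> a = 0" "n \<bullet> b = 0" "n \<bullet> c = 0"
  shows "area_form a b c = 0"
proof -
  have "(n \<bullet> n) * area_form a b c = (n \<bullet> a) * area_form n b c + (n \<bullet> b) * area_form a n c + (n \<bullet> c) * area_form a b n"
    by (simp add: area_form_def inner3 cross3_def) algebra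
  then show ?thesis using assms by simp
qed

lemma area_form_linear:
  "linear (\<lambda>a. area_form a b c)" "linear (\<lambda>b. area_form a b c)" "linear (\<lambda>c. area_form a b c)"
  by (rule linearI; simp add: area_form_def inner3 cross3_def algebra_simps)+

text \<open>
  The curl of \<open>euler_field\<close> on \<open>S3\<close>, as a homogeneous cubic field. Up to the orientation, it is the Hodge dual
  in \<open>real^4\<close> of the 3-form \<open>x\<^sup>\<flat> \<and> dV\<^sup>\<flat>\<close>, with \<open>V\<close> extended to \<open>real^4\<close> as \<open>euler_field\<close>.
\<close>

definition euler_curl :: "real^4 \<Rightarrow> real^4" where
  "euler_curl x = (let s = (x$2)\<^sup>2 + (x$3)\<^sup>2 + (x$4)\<^sup>2 in vector
    [- 16 * (x$1)\<^sup>2 * x$2,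
     16 * x$1 * ((x$1)\<^sup>2 - (x$3)\<^sup>2 - (x$4)\<^sup>2),
     16 * x$1 * x$2 * x$3 + 4 * x$4 * s - 28 * (x$1)\<^sup>2 * x$4,
     16 * x$1 * x$2 * x$4 - 4 * x$3 * s + 28 * (x$1)\<^sup>2 * x$3])"

lemma euler_curl_frame:
  assumes "x \<in> S3"
  shows "(euler_deriv x (X1 x) \<bullet> X2 x - euler_deriv x (X2 x) \<bullet> X1 x) *\<^sub>R \<xi> x
     + (euler_deriv x (X2 x) \<bullet> \<xi> x - euler_deriv x (\<xi> x) \<bullet> X2 x) *\<^sub>R X1 x
     + (euler_deriv x (\<xi> x) \<bullet> X1 x - euler_deriv x (X1 x) \<bullet> \<xi> x) *\<^sub>R X2 x = euler_curl x"
proof -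
  have "(euler_deriv x (X1 x) \<bullet> X2 x - euler_deriv x (X2 x) \<bullet> X1 x) *\<^sub>R \<xi> x
     + (euler_deriv x (X2 x) \<bullet> \<xi> x - euler_deriv x (\<xi> x) \<bullet> X2 x) *\<^sub>R X1 x
     + (euler_deriv x (\<xi> x) \<bullet> X1 x - euler_deriv x (X1 x) \<bullet> \<xi> x) *\<^sub>R X2 x =
     ((x$1)\<^sup>2 + (x$2)\<^sup>2 + (x$3)\<^sup>2 + (x$4)\<^sup>2) *\<^sub>R euler_curl x"
    by (simp add: vec_eq_iff forall_4 euler_deriv_def euler_curl_def Let_def inner4 \<xi>_def X1_def X2_def;
        intro conjI; algebra)
  then show ?thesis by (simp add: S3_components[OF assms])
qed

text \<open>
  The Euler-Lagrange equation of the energy: the curl of the Euler field covers a rotation of the target about the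
  axis on which the potential depends.
\<close>

lemma phi_deriv_curl:
  assumes "x \<in> S3"
  shows "phi_deriv x (euler_curl x) = 4 *\<^sub>R cross3 (hopf_map (\<psi> x)) (axis 3 1)"
proof -
  have "phi_deriv x (euler_curl x) =
    (4 * ((x$1)\<^sup>2 + (x$2)\<^sup>2 + (x$3)\<^sup>2 + (x$4)\<^sup>2)) *\<^sub>R cross3 (hopf_map (\<psi> x)) (axis 3 1)"
    by (simp add: vec_eq_iff forall_3 phi_deriv_def hopf_deriv_def psi_deriv_def euler_curl_def Let_def
        cross3_def hopf_map_def \<psi>_def axis_def; intro conjI; algebra)
  then show ?thesis by (simp add: S3_components[OF assms])
qed

text \<open>
  With \<open>p = \<phi> x\<close> of norm 1 and \<open>W\<close> tangent to the target at \<open>p\<close>, pairing \<open>W\<close> with \<open>4 p \<times> e\<^sub>3\<close> gives the derivative of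
  the third coordinate along \<open>W\<close>.
\<close>

lemma area_form_curl:
  assumes "x \<in> S3" "W \<bullet> hopf_map (\<psi> x) = 0"
  shows "area_form (hopf_map (\<psi> x)) W (phi_deriv x (euler_curl x)) = W $ 3"
proof -
  have n: "hopf_map (\<psi> x) \<bullet> hopf_map (\<psi> x) = 1"
    using hopf_S3[OF psi_S3[OF assms(1)]] by (simp add: S2_iff_inner)
  have "area_form p W (4 *\<^sub>R cross3 p (axis 3 1)) = (p \<bullet> p) * W $ 3 - (W \<bullet> p) * p $ 3" for p
    by (simp add: area_form_def inner3 cross3_def axis_def) algebra
  then show ?thesis by (simp add: phi_deriv_curl assms n)
qed

lemma sgn_idem: "sgn (sgn y) = sgn (y :: real^4)"
  by (cases "y = 0") (simp_all add: sgn_S3[OF sgn_in_S3])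

text \<open>
  The retraction is idempotent, so this is the chain rule for \<open>g \<circ> sgn = (g \<circ> sgn) \<circ> sgn\<close>.
\<close>

lemma differential_sgn:
  assumes "y \<noteq> 0" "(\<lambda>y. g (sgn y)) differentiable (at (sgn y))"
  shows "differential g (sgn y) (frechet_derivative sgn (at y) v) = frechet_derivative (\<lambda>y. g (sgn y)) (at y) v"
proof -
  have s: "((sgn :: real^4 \<Rightarrow> _) has_derivative frechet_derivative sgn (at y)) (at y)"
    using differentiableI[OF sgn_has_derivative[OF assms(1)]] by (simp add: frechet_derivative_works)
  have "((\<lambda>y. g (sgn y)) has_derivative differential g (sgn y)) (at (sgn y))"
    using assms(2) by (simp add: frechet_derivative_works differential_def)
  from has_derivative_compose[OF s this]
  have "((\<lambda>y. g (sgn y)) has_derivative (\<lambda>v. differential g (sgn y) (frechet_derivative sgn (at y) v))) (at y)"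
    by (simp add: sgn_idem)
  from frechet_derivative_at[OF this] show ?thesis by (simp add: fun_eq_iff)
qed

lemma continuous_frame_coords:
  "continuous_on T (\<lambda>q. \<xi> (S3_coords q))" "continuous_on T (\<lambda>q. X1 (S3_coords q))" "continuous_on T (\<lambda>q. X2 (S3_coords q))"
proof -
  have c: "continuous_on T (\<lambda>q. S3_coords q $ i)" for i
    by (intro continuous_intros continuous_coords)
  have "\<forall>i. continuous_on T (\<lambda>q. \<xi> (S3_coords q) $ i)" "\<forall>i. continuous_on T (\<lambda>q. X1 (S3_coords q) $ i)"
    "\<forall>i. continuous_on T (\<lambda>q. X2 (S3_coords q) $ i)"
    unfolding forall_4 \<xi>_def X1_def X2_def by (auto intro!: continuous_intros c)
  then show "continuous_on T (\<lambda>q. \<xi> (S3_coords q))" "continuous_on T (\<lambda>q. X1 (S3_coords q))" "continuous_on T (\<lambda>q. X2 (S3_coords q))"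
    by (auto intro: continuous_on_vec4)
qed

section \<open>The first variation of the energy\<close>

context
  fixes \<epsilon> :: real and \<Phi> :: "real \<Rightarrow> real^4 \<Rightarrow> real^3"
  assumes var: "smooth_variation hopf_psi \<epsilon> \<Phi>"
begin

text \<open>
  The variation as a single map \<open>f\<close> of \<open>(t, y)\<close>, with its first and second directional derivatives \<open>D\<close> and \<open>DD\<close>.
  Here \<open>W\<close> is the variation field at \<open>t = 0\<close>, and \<open>\<beta>\<close> its contraction with the area form.
\<close>

private definition "f = (\<lambda>(t, y). \<Phi> t (sgn y))"
private definition "I = {-\<epsilon><..<\<epsilon>}"
private definition "S = I \<times> (- {0::real^4})"
private definition "D u z = frechet_derivative f (at z) u"
private definition "DD u z u' = frechet_derivative (D u) (at z) u'"
private definition "W y = D (1, 0) (0, y)"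
private definition "\<beta> x v = area_form (hopf_psi x) (W x) (differential hopf_psi x v)"

private lemma eps: "0 < \<epsilon>" using var by (simp add: smooth_variation_def)

private lemma zero_I: "0 \<in> I" using eps by (simp add: I_def)

private lemma open_S: "open S" unfolding S_def I_def by (intro open_Times) auto

private lemma Ck_f: "Ck_on k f S"
  using var by (simp add: smooth_variation_def smooth_on_def f_def S_def I_def)

private lemma f_deriv: "z \<in> S \<Longrightarrow> (f has_derivative (\<lambda>u. D u z)) (at z)"
  using Ck_on_Suc_has_derivative[OF Ck_f] by (simp add: D_def)

private lemma Ck_D: "Ck_on k (D u) S"
  using Ck_on_Suc_deriv[OF Ck_f] by (simp add: D_def[abs_def])

private lemma D_deriv: "z \<in> S \<Longrightarrow> (D u has_derivative DD u z) (at z)"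
  using Ck_on_Suc_has_derivative[OF Ck_D] by (simp add: DD_def[abs_def])

private lemma DD_sym: "z \<in> S \<Longrightarrow> DD u z u' = DD u' z u"
  using second_derivative_symmetric[OF Ck_f open_S] by (simp add: DD_def D_def[abs_def])

private lemma f_unit:
  assumes "z \<in> S" shows "f z \<bullet> f z = 1"
proof -
  obtain t y where z: "z = (t, y)" by (cases z)
  have "\<Phi> t (sgn y) \<in> S2"
    using assms var sgn_in_S3[of y]
    by (auto simp: z S_def I_def smooth_variation_def image_subset_iff)
  then show ?thesis by (simp add: f_def z S2_iff_inner)
qed

text \<open>
  Differentiating \<open>f \<bullet> f = 1\<close>: all first derivatives of the variation are tangent to the target sphere.
\<close>

private lemma f_orth_D:
  assumes "z \<in> S" shows "f z \<bullet> D u z = 0"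
proof -
  have "((\<lambda>z. f z \<bullet> f z) has_derivative (\<lambda>u. f z \<bullet> D u z + D u z \<bullet> f z)) (at z)"
    by (intro has_derivative_inner f_deriv assms)
  then have "((\<lambda>z. 1) has_derivative (\<lambda>u. f z \<bullet> D u z + D u z \<bullet> f z)) (at z)"
    by (rule has_derivative_transform_within_open[OF _ open_S assms]) (rule f_unit)
  from fun_cong[OF has_derivative_unique[OF this has_derivative_const], of u] show ?thesis
    by (simp add: inner_commute)
qed

private lemma along_y:
  assumes "(g has_derivative g') (at (t, y))"
  shows "((\<lambda>y. g (t, y)) has_derivative (\<lambda>v. g' (0, v))) (at y)"
  by (rule has_derivative_compose[where f="\<lambda>y. (t, y)" and g=g, OF _ assms])
     (intro has_derivative_Pair has_derivative_const has_derivative_ident)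

private lemma along_t:
  assumes "(g has_derivative g') (at (t, y))"
  shows "((\<lambda>t. g (t, y)) has_derivative (\<lambda>h. h *\<^sub>R g' (1, 0))) (at t within T)"
proof -
  have "((\<lambda>t. g (t, y)) has_derivative (\<lambda>h. g' (h, 0))) (at t within T)"
    by (rule has_derivative_compose[where f="\<lambda>t. (t, y)" and g=g, OF _ assms])
       (intro has_derivative_Pair has_derivative_const has_derivative_ident)
  moreover have "g' (h, 0) = h *\<^sub>R g' (1, 0)" for h
    using linear_scale[OF has_derivative_linear[OF assms], of h "(1, 0)"] by simp
  then have "(\<lambda>h. g' (h, 0)) = (\<lambda>h. h *\<^sub>R g' (1, 0))" by (rule ext)
  ultimately show ?thesis by (rule subst[rotated])
qed

private lemma differential_variation:
  assumes "t \<in> I" "x \<in> S3"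
  shows "differential (\<Phi> t) x v = D (0, v) (t, x)"
proof -
  have "(t, x) \<in> S" using assms S3_nonzero by (auto simp: S_def)
  from frechet_derivative_at[OF along_y[OF f_deriv[OF this]]] show ?thesis
    by (simp add: differential_def f_def fun_eq_iff)
qed

private lemma f_0: "y \<noteq> 0 \<Longrightarrow> f (0, y) = hopf_psi (sgn y)"
  using var sgn_in_S3[of y] by (simp add: f_def smooth_variation_def)

private lemma frechet_f_0:
  assumes "y \<noteq> 0"
  shows "((\<lambda>y. hopf_psi (sgn y)) has_derivative (\<lambda>v. D (0, v) (0, y))) (at y)"
proof -
  have "(0, y) \<in> S" using assms zero_I by (simp add: S_def)
  from along_y[OF f_deriv[OF this]] show ?thesis
    by (rule has_derivative_transform_within_open[where s="- {0}"]) (use assms f_0 in auto)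
qed

private lemma W_sgn:
  assumes "y \<noteq> 0" shows "W (sgn y) = W y"
proof -
  have 1: "(0, y) \<in> S" "(0, sgn y) \<in> S" using assms zero_I by (simp_all add: S_def sgn_zero_iff)
  have "(\<lambda>t. f (t, sgn y)) = (\<lambda>t. f (t, y))" by (simp add: f_def sgn_idem)
  then have "((\<lambda>t. f (t, y)) has_derivative (\<lambda>h. h *\<^sub>R D (1, 0) (0, sgn y))) (at 0)"
    using along_t[OF f_deriv[OF 1(2)], of UNIV] by simp
  from fun_cong[OF has_derivative_unique[OF this along_t[OF f_deriv[OF 1(1)]]], of 1]
  show ?thesis by (simp add: W_def)
qed

private lemma radial_pullback_\<beta>:
  assumes "y \<noteq> 0"
  shows "radial_pullback \<beta> y v = area_form (f (0, y)) (D (1, 0) (0, y)) (D (0, v) (0, y))"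
proof -
  have s: "sgn y \<noteq> 0" using assms by (simp add: sgn_zero_iff)
  have "differential hopf_psi (sgn y) (frechet_derivative sgn (at y) v) = frechet_derivative (\<lambda>y. hopf_psi (sgn y)) (at y) v"
    by (rule differential_sgn[OF assms differentiableI[OF frechet_f_0[OF s]]])
  also have "\<dots> = D (0, v) (0, y)"
    using frechet_derivative_at[OF frechet_f_0[OF assms]] by (simp add: fun_eq_iff)
  finally show ?thesis
    using W_sgn[OF assms] f_0[OF assms] by (simp add: radial_pullback_def \<beta>_def W_def)
qed

private lemma C1_\<beta>: "C1_form \<beta>"
  unfolding C1_form_def
proof (intro conjI ballI allI)
  fix x assume x: "x \<in> S3"
  have "linear (\<lambda>v. area_form (hopf_psi x) (W x) (phi_deriv x v))"
    using linear_compose[OF linear_phi_deriv area_form_linear(3)] by (simp add: o_def)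
  moreover have "\<beta> x v = area_form (hopf_psi x) (W x) (phi_deriv x v)" if "v \<in> tangent x" for v
    using differential_phi[OF x that] by (simp add: \<beta>_def)
  ultimately show "\<exists>L. linear L \<and> (\<forall>v\<in>tangent x. \<beta> x v = L v)" by blast
next
  fix v
  have L: "bounded_linear (\<lambda>y. (0::real, y::real^4))"
    by (rule bounded_linear_Pair[OF bounded_linear_zero bounded_linear_ident])
  have r: "Ck_on k (\<lambda>y. g (0, y)) (- {0})" if "Ck_on k g S" for g :: "real \<times> (real^4) \<Rightarrow> real^3" and k
    using Ck_on_affine_compose[OF that open_punctured L, of "(0, 0)"] zero_I by (simp add: S_def)
  have "Ck_on (Suc 0) (\<lambda>y. area_form (f (0, y)) (D (1, 0) (0, y)) (D (0, v) (0, y))) (- {0})"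
    by (intro Ck_on_area_form r Ck_f Ck_D open_punctured)
  then show "Ck_on (Suc 0) (\<lambda>y. radial_pullback \<beta> y v) (- {0})"
    by (rule Ck_on_cong[OF _ open_punctured]) (simp add: radial_pullback_\<beta>)
qed

text \<open>
  Of the six terms given by the product rule, the two with a factor \<open>d\<phi>\<close> in the first slot vanish as determinants
  of coplanar vectors, and the two with second derivatives of \<open>\<phi>\<close> cancel by symmetry.
\<close>

private lemma ext_deriv_\<beta>:
  assumes x: "x \<in> S3"
  shows "ext_deriv \<beta> x v w =
    area_form (f (0, x)) (DD (0, v) (0, x) (1, 0)) (D (0, w) (0, x)) +
    area_form (f (0, x)) (D (0, v) (0, x)) (DD (0, w) (0, x) (1, 0))"
proof -
  have nz: "x \<noteq> 0" using S3_nonzero[OF x] .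
  have z: "(0, x) \<in> S" using nz zero_I by (simp add: S_def)
  have R: "frechet_derivative (\<lambda>y. radial_pullback \<beta> y w) (at x) v =
     area_form (f (0, x)) (DD (1, 0) (0, x) (0, v)) (D (0, w) (0, x)) +
     area_form (f (0, x)) (D (1, 0) (0, x)) (DD (0, w) (0, x) (0, v))" for v w
  proof -
    have "((\<lambda>y. area_form (f (0, y)) (D (1, 0) (0, y)) (D (0, w) (0, y))) has_derivative
      (\<lambda>v. area_form (D (0, v) (0, x)) (D (1, 0) (0, x)) (D (0, w) (0, x)) +
        area_form (f (0, x)) (DD (1, 0) (0, x) (0, v)) (D (0, w) (0, x)) +
        area_form (f (0, x)) (D (1, 0) (0, x)) (DD (0, w) (0, x) (0, v)))) (at x)"
      by (intro area_form_has_derivative along_y f_deriv D_deriv z)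
    then have "((\<lambda>y. radial_pullback \<beta> y w) has_derivative
      (\<lambda>v. area_form (D (0, v) (0, x)) (D (1, 0) (0, x)) (D (0, w) (0, x)) +
        area_form (f (0, x)) (DD (1, 0) (0, x) (0, v)) (D (0, w) (0, x)) +
        area_form (f (0, x)) (D (1, 0) (0, x)) (DD (0, w) (0, x) (0, v)))) (at x)"
      by (rule has_derivative_transform_within_open[where s="- {0}"])
         (use nz in \<open>auto simp: radial_pullback_\<beta>\<close>)
    from fun_cong[OF frechet_derivative_at[OF this, symmetric], of v]
    show ?thesis
      by (simp add: area_form_orthogonal_zero[of "f (0, x)"] f_unit[OF z] f_orth_D[OF z])
  qed
  show ?thesis
    unfolding ext_deriv_def R DD_sym[OF z, of "(1, 0)"] DD_sym[OF z, of "(0, w)" "(0, v)"]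
    using area_form_skew[of "f (0, x)" "DD (0, w) (0, x) (1, 0)" "D (0, v) (0, x)"] by simp
qed

text \<open>
  The coefficient on \<open>p\<close> and \<open>q\<close> of the pullback of the area form along the variation, and its \<open>t\<close>-derivative.
\<close>

private definition "N p q z = area_form (f z) (D (0, p) z) (D (0, q) z)"

private definition "N' p q z = area_form (D (1, 0) z) (D (0, p) z) (D (0, q) z)
    + area_form (f z) (DD (0, p) z (1, 0)) (D (0, q) z) + area_form (f z) (D (0, p) z) (DD (0, q) z (1, 0))"

private lemma N_deriv:
  assumes "(t, x) \<in> S"
  shows "((\<lambda>t. N p q (t, x)) has_real_derivative N' p q (t, x)) (at t within T)"
proof -
  have "((\<lambda>t. N p q (t, x)) has_derivative
    (\<lambda>h. area_form (h *\<^sub>R D (1, 0) (t, x)) (D (0, p) (t, x)) (D (0, q) (t, x))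
       + area_form (f (t, x)) (h *\<^sub>R DD (0, p) (t, x) (1, 0)) (D (0, q) (t, x))
       + area_form (f (t, x)) (D (0, p) (t, x)) (h *\<^sub>R DD (0, q) (t, x) (1, 0)))) (at t within T)"
    unfolding N_def by (intro area_form_has_derivative along_t f_deriv D_deriv assms)
  then show ?thesis
    unfolding has_field_derivative_def
    by (rule has_derivative_eq_rhs) (simp add: fun_eq_iff N'_def linear_scale[OF area_form_linear(1)]
        linear_scale[OF area_form_linear(2)] linear_scale[OF area_form_linear(3)] algebra_simps)
qed

text \<open>
  The infinitesimal form of homotopy invariance: along a variation the pullback of the area form changes by the exact
  form \<open>d\<beta>\<close>.
\<close>

private lemma N'_0: "x \<in> S3 \<Longrightarrow> N' v w (0, x) = ext_deriv \<beta> x v w"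
proof -
  assume x: "x \<in> S3"
  then have z: "(0, x) \<in> S" using S3_nonzero zero_I by (auto simp: S_def)
  show ?thesis
    by (simp add: N'_def ext_deriv_\<beta>[OF x] area_form_orthogonal_zero[of "f (0, x)"] f_unit[OF z] f_orth_D[OF z])
qed

text \<open>
  The energy density and its \<open>t\<close>-derivative; \<open>z = (t, x)\<close> carries the point at which the frame is taken.
\<close>

private definition "dens z = (let x = snd z in
  (N (X1 x) (X2 x) z)\<^sup>2 + (N (X2 x) (\<xi> x) z)\<^sup>2 + (N (\<xi> x) (X1 x) z)\<^sup>2 + 2 * (1 - f z $ 3))"

private definition "dens' z = (let x = snd z in
  2 * N (X1 x) (X2 x) z * N' (X1 x) (X2 x) z + 2 * N (X2 x) (\<xi> x) z * N' (X2 x) (\<xi> x) z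
  + 2 * N (\<xi> x) (X1 x) z * N' (\<xi> x) (X1 x) z - 2 * D (1, 0) z $ 3)"

private lemma dens_deriv:
  assumes "(t, x) \<in> S"
  shows "((\<lambda>t. dens (t, x)) has_real_derivative dens' (t, x)) (at t within T)"
proof -
  have "((\<lambda>t. f (t, x) $ 3) has_derivative (\<lambda>h. (h *\<^sub>R D (1, 0) (t, x)) $ 3)) (at t within T)"
    by (rule bounded_linear.has_derivative[OF bounded_linear_vec_nth along_t[OF f_deriv[OF assms]]])
  then have "((\<lambda>t. f (t, x) $ 3) has_real_derivative D (1, 0) (t, x) $ 3) (at t within T)"
    by (simp add: has_field_derivative_def mult_commute_abs)
  then show ?thesis
    unfolding dens_def dens'_def Let_def snd_conv
    by (auto intro!: derivative_eq_intros N_deriv[OF assms])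
qed

private lemma energy_density:
  assumes "t \<in> I" "x \<in> S3"
  shows "(form2_norm (pullback_area (\<Phi> t)) x)\<^sup>2 + 2 * (1 - \<Phi> t x $ 3) = dens (t, x)"
  by (simp add: form2_norm_def dens_def N_def pullback_area_def differential_variation[OF assms])
     (simp add: f_def sgn_S3[OF assms(2)])

private abbreviation "coord_box \<equiv> cbox (0, 0, 0) (pi/2, 2*pi, 2*pi) :: (real \<times> real \<times> real) set"
private abbreviation "jac q \<equiv> sin (fst q) * cos (fst q)"

private lemma energy:
  assumes "t \<in> I"
  shows "FS_energy (\<Phi> t) = 1/2 * integral coord_box (\<lambda>q. dens (t, S3_coords q) * jac q)"
  unfolding FS_energy_def S3_integral_vol[OF refl]
  by (simp only: energy_density[OF assms S3_coords_in_S3])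

private lemma coords_S: "t \<in> I \<Longrightarrow> (t, S3_coords q) \<in> S"
  using S3_nonzero[OF S3_coords_in_S3] by (simp add: S_def)

private lemma cont_D:
  assumes "continuous_on T z" "continuous_on T u" "\<And>p. p \<in> T \<Longrightarrow> z p \<in> S"
  shows "continuous_on T (\<lambda>p. D (u p) (z p))"
  unfolding D_def by (rule continuous_on_frechet_derivative[OF Ck_f assms])

private lemma cont_DD:
  assumes "continuous_on T z" "continuous_on T u" "\<And>p. p \<in> T \<Longrightarrow> z p \<in> S"
  shows "continuous_on T (\<lambda>p. DD (u p) (z p) (1, 0))"
  unfolding DD_def D_def
  by (rule continuous_on_frechet_derivative2[OF Ck_f open_S assms(1,2) continuous_on_const assms(3)])

private lemma cont_f:
  assumes "continuous_on T z" "\<And>p. p \<in> T \<Longrightarrow> z p \<in> S"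
  shows "continuous_on T (\<lambda>p. f (z p))"
  by (rule continuous_on_compose2[OF Ck_on_imp_continuous_on[OF Ck_f]]) (use assms in auto)

private lemma cont_N:
  assumes "continuous_on T z" "continuous_on T u" "continuous_on T v" "\<And>p. p \<in> T \<Longrightarrow> z p \<in> S"
  shows "continuous_on T (\<lambda>p. N (u p) (v p) (z p))"
  unfolding N_def by (intro continuous_on_area_form cont_f cont_D continuous_intros assms)

private lemma cont_N':
  assumes "continuous_on T z" "continuous_on T u" "continuous_on T v" "\<And>p. p \<in> T \<Longrightarrow> z p \<in> S"
  shows "continuous_on T (\<lambda>p. N' (u p) (v p) (z p))"
  unfolding N'_def by (intro continuous_on_add continuous_on_area_form cont_f cont_D cont_DD continuous_intros assms)

private lemma cont_frame:
  fixes q :: "'c::topological_space \<Rightarrow> real \<times> real \<times> real"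
  assumes "continuous_on T q"
  shows "continuous_on T (\<lambda>p. S3_coords (q p))" "continuous_on T (\<lambda>p. \<xi> (S3_coords (q p)))"
    "continuous_on T (\<lambda>p. X1 (S3_coords (q p)))" "continuous_on T (\<lambda>p. X2 (S3_coords (q p)))"
proof -
  have c: "continuous_on T (\<lambda>p. g (q p))" if "continuous_on UNIV g" for g :: "_ \<Rightarrow> real^4"
    by (rule continuous_on_compose2[OF that assms subset_UNIV])
  show "continuous_on T (\<lambda>p. S3_coords (q p))" by (rule c) (rule continuous_coords)
  show "continuous_on T (\<lambda>p. \<xi> (S3_coords (q p)))"
    by (rule c[of "\<lambda>q. \<xi> (S3_coords q)"]) (rule continuous_frame_coords)
  show "continuous_on T (\<lambda>p. X1 (S3_coords (q p)))"
    by (rule c[of "\<lambda>q. X1 (S3_coords q)"]) (rule continuous_frame_coords)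
  show "continuous_on T (\<lambda>p. X2 (S3_coords (q p)))"
    by (rule c[of "\<lambda>q. X2 (S3_coords q)"]) (rule continuous_frame_coords)
qed

private lemma cont_dens:
  fixes q :: "'c::topological_space \<Rightarrow> real \<times> real \<times> real"
  assumes "continuous_on T t" "continuous_on T q" "\<And>p. p \<in> T \<Longrightarrow> t p \<in> I"
  shows "continuous_on T (\<lambda>p. dens (t p, S3_coords (q p)))" "continuous_on T (\<lambda>p. dens' (t p, S3_coords (q p)))"
proof -
  let ?x = "\<lambda>p. S3_coords (q p)"
  have z: "continuous_on T (\<lambda>p. (t p, ?x p))"
    by (rule continuous_on_Pair[OF assms(1) cont_frame(1)[OF assms(2)]])
  have zS: "(t p, ?x p) \<in> S" if "p \<in> T" for p
    by (rule coords_S[OF assms(3)[OF that]])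
  note fr = cont_frame[OF assms(2)]
  note 1 = cont_N[OF z fr(3,4) zS] cont_N[OF z fr(4,2) zS] cont_N[OF z fr(2,3) zS]
    cont_N'[OF z fr(3,4) zS] cont_N'[OF z fr(4,2) zS] cont_N'[OF z fr(2,3) zS]
  have 2: "continuous_on T (\<lambda>p. f (t p, ?x p) $ 3)" "continuous_on T (\<lambda>p. D (1, 0) (t p, ?x p) $ 3)"
    by (rule continuous_on_component, rule cont_f[OF z zS], assumption)
       (rule continuous_on_component, rule cont_D[OF z continuous_on_const zS], assumption)
  show "continuous_on T (\<lambda>p. dens (t p, ?x p))"
    unfolding dens_def Let_def snd_conv
    by (rule 1 2 continuous_on_add continuous_on_power continuous_on_mult continuous_on_diff continuous_on_const | assumption)+
  show "continuous_on T (\<lambda>p. dens' (t p, ?x p))"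
    unfolding dens'_def Let_def snd_conv
    by (rule 1 2 continuous_on_add continuous_on_mult continuous_on_diff continuous_on_const | assumption)+
qed

private lemma energy_deriv:
  "((\<lambda>t. FS_energy (\<Phi> t)) has_real_derivative 1/2 * integral coord_box (\<lambda>q. dens' (0, S3_coords q) * jac q)) (at 0)"
proof -
  have "((\<lambda>t. integral coord_box (\<lambda>q. dens (t, S3_coords q) * jac q)) has_real_derivative
      integral coord_box (\<lambda>q. dens' (0, S3_coords q) * jac q)) (at 0 within I)"
  proof (rule leibniz_rule_field_derivative)
    show "((\<lambda>t. dens (t, S3_coords q) * jac q) has_real_derivative dens' (t, S3_coords q) * jac q) (at t within I)"
      if "t \<in> I" for t q
      by (rule DERIV_cmult_right[OF dens_deriv[OF coords_S[OF that]]])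
    show "(\<lambda>q. dens (t, S3_coords q) * jac q) integrable_on coord_box" if "t \<in> I" for t
      by (intro integrable_continuous continuous_intros cont_dens that)
    show "continuous_on (I \<times> coord_box) (\<lambda>(t, q). dens' (t, S3_coords q) * jac q)"
      unfolding case_prod_beta by (intro continuous_intros cont_dens) auto
    show "0 \<in> I" by (rule zero_I)
    show "convex I" by (simp add: I_def)
  qed
  then have "((\<lambda>t. 1/2 * integral coord_box (\<lambda>q. dens (t, S3_coords q) * jac q)) has_real_derivative
      1/2 * integral coord_box (\<lambda>q. dens' (0, S3_coords q) * jac q)) (at 0)"
    unfolding at_within_open[OF zero_I open_greaterThanLessThan[of "- \<epsilon>" \<epsilon>, folded I_def]]
    by (rule DERIV_cmult)
  then show ?thesis
    by (rule has_field_derivative_transform_within_open[of _ _ _ I])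
       (use zero_I energy in \<open>auto simp: I_def\<close>)
qed

private lemma dens'_0:
  assumes x: "x \<in> S3"
  shows "dens' (0, x) = 2 * wedge12 (\<lambda>x v. euler_field x \<bullet> v) (ext_deriv \<beta>) x (\<xi> x) (X1 x) (X2 x) - 2 * W x $ 3"
proof -
  have N: "N v w (0, x) = pullback_area hopf_psi x v w" if "v \<in> tangent x" "w \<in> tangent x" for v w
  proof -
    have "D (0, v) (0, x) = differential hopf_psi x v" for v
      using frechet_derivative_at[OF frechet_f_0[OF S3_nonzero[OF x]]] by (simp add: differential_def fun_eq_iff)
    then show ?thesis
      using f_0[OF S3_nonzero[OF x]] by (simp add: N_def pullback_area_def sgn_S3[OF x])
  qed
  have "euler_field x \<bullet> \<xi> x = 4 * x$1 * x$1" "euler_field x \<bullet> X1 x = - 4 * x$1 * x$4" "euler_field x \<bullet> X2 x = 4 * x$1 * x$3"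
    using frame_orthonormal[OF x] inner_commute[of "X1 x" "\<xi> x"] inner_commute[of "X2 x" "X1 x"]
      inner_commute[of "\<xi> x" "X2 x"]
    by (simp_all add: euler_field_def inner_add_left inner_diff_left)
  then show ?thesis
    by (simp add: dens'_def Let_def N frame_tangent pullback_area_phi_frame[OF x] N'_0[OF x] wedge12_def W_def)
qed

text \<open>
  The wedge product with \<open>dV\<^sup>\<flat>\<close> evaluates \<open>\<beta>\<close> on the curl of \<open>V\<close>.
\<close>

private lemma \<beta>_curl:
  assumes x: "x \<in> S3"
  shows "wedge12 \<beta> (ext_deriv (\<lambda>x v. euler_field x \<bullet> v)) x (\<xi> x) (X1 x) (X2 x) = W x $ 3"
proof -
  have z: "(0, x) \<in> S" using S3_nonzero[OF x] zero_I by (simp add: S_def)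
  have f: "f (0, x) = hopf_map (\<psi> x)"
    using f_0[OF S3_nonzero[OF x]] by (simp add: sgn_S3[OF x])
  have W: "W x \<bullet> hopf_map (\<psi> x) = 0"
    using f_orth_D[OF z, of "(1, 0)"] by (simp add: W_def f inner_commute)
  define L where "L = (\<lambda>v. area_form (hopf_map (\<psi> x)) (W x) (phi_deriv x v))"
  have L: "linear L" unfolding L_def
    using linear_compose[OF linear_phi_deriv area_form_linear(3)] by (simp add: o_def)
  have \<beta>: "\<beta> x v = L v" if "v \<in> tangent x" for v
    using differential_phi[OF x that] by (simp add: \<beta>_def L_def)
  have "wedge12 \<beta> (ext_deriv (\<lambda>x v. euler_field x \<bullet> v)) x (\<xi> x) (X1 x) (X2 x) =
      L ((euler_deriv x (X1 x) \<bullet> X2 x - euler_deriv x (X2 x) \<bullet> X1 x) *\<^sub>R \<xi> x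
     + (euler_deriv x (X2 x) \<bullet> \<xi> x - euler_deriv x (\<xi> x) \<bullet> X2 x) *\<^sub>R X1 x
     + (euler_deriv x (\<xi> x) \<bullet> X1 x - euler_deriv x (X1 x) \<bullet> \<xi> x) *\<^sub>R X2 x)"
    by (simp add: wedge12_def \<beta> frame_tangent ext_deriv_inner_field[OF euler_field_has_derivative x]
        linear_add[OF L] linear_scale[OF L])
  also have "\<dots> = W x $ 3"
    unfolding euler_curl_frame[OF x] L_def by (rule area_form_curl[OF x W])
  finally show ?thesis .
qed

private lemma first_variation: "integral coord_box (\<lambda>q. dens' (0, S3_coords q) * jac q) = 0"
proof -
  define \<alpha> where "\<alpha> = (\<lambda>x v. euler_field x \<bullet> v)"
  have C: "C1_form \<alpha>"
    unfolding \<alpha>_def by (intro smooth_form1_imp_C1 smooth_form1_inner_field smooth_euler refl)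
  have c: "continuous_on coord_box (\<lambda>q. dens' (0, S3_coords q) * jac q)" "continuous_on coord_box (\<lambda>q. 2 * W (S3_coords q) $ 3 * jac q)"
    unfolding W_def by (intro continuous_intros cont_dens cont_D continuous_coords coords_S zero_I; assumption?)+
  have "S3_integral (wedge12 \<alpha> (ext_deriv \<beta>)) = integral coord_box (\<lambda>q. wedge12 \<alpha> (ext_deriv \<beta>) (S3_coords q) (\<xi> (S3_coords q)) (X1 (S3_coords q)) (X2 (S3_coords q)) * jac q)"
    by (rule S3_integral_vol) (rule wedge12_ext_deriv_vol[OF C C1_\<beta>])
  also have "\<dots> = integral coord_box (\<lambda>q. 1/2 * (dens' (0, S3_coords q) * jac q + 2 * W (S3_coords q) $ 3 * jac q))"
    by (rule integral_cong) (simp add: dens'_0[OF S3_coords_in_S3] \<alpha>_def[symmetric] algebra_simps)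
  also have "\<dots> = 1/2 * (integral coord_box (\<lambda>q. dens' (0, S3_coords q) * jac q) + integral coord_box (\<lambda>q. 2 * W (S3_coords q) $ 3 * jac q))"
    by (simp only: integral_mult_right integral_add[OF integrable_continuous[OF c(1)] integrable_continuous[OF c(2)]])
  finally have 1: "S3_integral (wedge12 \<alpha> (ext_deriv \<beta>)) = \<dots>" .
  have "S3_integral (wedge12 \<beta> (ext_deriv \<alpha>)) = integral coord_box (\<lambda>q. wedge12 \<beta> (ext_deriv \<alpha>) (S3_coords q) (\<xi> (S3_coords q)) (X1 (S3_coords q)) (X2 (S3_coords q)) * jac q)"
    by (rule S3_integral_vol) (rule wedge12_ext_deriv_vol[OF C1_\<beta> C])
  also have "\<dots> = integral coord_box (\<lambda>q. 1/2 * (2 * W (S3_coords q) $ 3 * jac q))"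
    by (rule integral_cong) (simp add: \<beta>_curl[OF S3_coords_in_S3] \<alpha>_def)
  also have "\<dots> = 1/2 * integral coord_box (\<lambda>q. 2 * W (S3_coords q) $ 3 * jac q)"
    by (simp only: integral_mult_right)
  finally show ?thesis
    using 1 stokes_S3[OF C C1_\<beta>] by simp
qed

lemma FS_energy_variation: "((\<lambda>t. FS_energy (\<Phi> t)) has_real_derivative 0) (at 0)"
  using energy_deriv by (simp add: first_variation)

end

lemma FS_critical_phi: "FS_critical hopf_psi"
  unfolding FS_critical_def smooth_map_S3_S2_def
proof (intro conjI allI impI)
  show "hopf_psi ` S3 \<subseteq> S2" using hopf_S3 psi_S3 by auto
qed (rule smooth_phi, rule FS_energy_variation)

theorem proposition1:
  fixes \<phi> :: "real^4 \<Rightarrow> real^3" and V :: "real^4 \<Rightarrow> real^4" and b p :: "real^4 \<Rightarrow> real"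
  assumes "\<phi> = hopf_map \<circ> \<psi>"
    and "V = sharp (hodge_star (pullback_area \<phi>))"
    and "b = (\<lambda>x. 8 * (x$1)\<^sup>2 * ((x$3)\<^sup>2 + (x$4)\<^sup>2))"
    and "p = (\<lambda>x. - 8 * (x$1)^4)"
  shows "(steady_euler_field V \<and> S2_integrable V \<and>
      steady_euler_with_pressure V p \<and> (\<forall>x\<in>S3. bernoulli V p x = b x) \<and>
      (\<forall>x\<in>S3. V x = (4 * x$1) *\<^sub>R (x$1 *\<^sub>R \<xi> x - x$4 *\<^sub>R X1 x + x$3 *\<^sub>R X2 x))) \<and>
    (almost_submersion \<phi> \<and> FS_critical \<phi> \<and> has_hopf_invariant \<phi> 2)"
proof -
  have V: "V x = euler_field x" if "x \<in> S3" for x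
    unfolding assms(1,2) by (rule sharp_hodge_star_phi[OF that])
  have E: "steady_euler_with_pressure V p"
    unfolding assms(4) by (rule steady_euler_euler_field[OF V])
  have "bernoulli V p x = b x" if "x \<in> S3" for x
    using euler_field_inner[OF that]
    by (simp add: bernoulli_def V[OF that] assms(3,4) power2_norm_eq_inner)
      (simp add: algebra_simps power_numeral_reduce)
  moreover have "V x = (4 * x$1) *\<^sub>R (x$1 *\<^sub>R \<xi> x - x$4 *\<^sub>R X1 x + x$3 *\<^sub>R X2 x)" if "x \<in> S3" for x
    using V[OF that] by (simp only: euler_field_def)
  ultimately show ?thesis
    unfolding assms(1)[symmetric]
    using E S2_integrable_euler[OF V] almost_submersion_phi FS_critical_phi hopf_invariant_phi
    by (auto simp: steady_euler_field_def assms(1) simp del: o_apply)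
qed

end
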